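(* Let $\Sigma<\Gamma$ be countable groups. Let $\Sigma\curvearrowright (X_0,\mu_0)$ be any p.m.p. action and let $\Gamma\curvearrowright (X,\mu)=(X_0,\mu_0)^{\Gamma/\Sigma}$ be the associated coinduced action. Let $\Delta<\Gamma$ be a subgroup that is not amenable relative to $\Sigma$ inside $\Gamma$. Then the restricted action $\Delta\curvearrowright (X,\mu)$ has spectral gap. In particular, $\mathcal R_{\Delta\curvearrowright X}$ is strongly ergodic.
   Context: P.m.p. means probability measure preserving; actions are on standard probability spaces. $\mathcal R_{\Delta\curvearrowright X}=\{(x_1,x_2)\in X\times X : \Delta\cdot x_1=\Delta\cdot x_2\}$ is the orbit equivalence relation. Coinduced action: let $\Sigma<\Gamma$ be countable groups, $I=\Gamma/\Sigma$, let $\phi:I\to\Gamma$ be a section of the quotient map, and define $c:\Gamma\times I\to\Sigma$ by $c(g,i)=\phi(gi)^{-1}g\phi(i)$. For an action $\Sigma\overset{\sigma_0}{\curvearrowright}(X_0,\mu_0)$, the coinduced action $\Gamma\overset{\sigma}{\curvearrowright}(X_0,\mu_0)^I$ is given by $(\sigma_g(x))_{gi}=(\sigma_0)_{c(g,i)}(x_i)$ for all $g\in\Gamma$, $i\in I$, $x=(x_i)_{i\in I}\in X_0^I$. For subgroups $\Delta,\Sigma<\Gamma$, $\Delta$ is amenable relative to $\Sigma$ inside $\Gamma$ if the left translation action of $\Delta$ on $\Gamma/\Sigma$ admits an invariant mean. A p.m.p. action $\Delta\curvearrowright(X,\mu)$ has spectral gap if the Koopman representation of $\Delta$ on $L^2(X,\mu)\ominus\mathbb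 C1$ has no almost invariant vectors, i.e. there is no sequence of unit vectors $\xi_n\in L^2(X,\mu)\ominus\mathbb C1$ with $\|g\cdot\xi_n-\xi_n\|_2\to0$ for every $g\in\Delta$. A countable p.m.p. equivalence relation $\mathcal R$ on $(X,\mu)$ with full group $[\mathcal R]$ is strongly ergodic if for every sequence of measurable sets $A_n\subset X$ satisfying $\lim_n\mu(\alpha(A_n)\,\triangle\, A_n)=0$ for all $\alpha\in[\mathcal R]$, one has $\lim_n\mu(A_n)(1-\mu(A_n))=0$. *)

theory Defs
  imports
    "HOL-Probability.Probability"
    "HOL-Algebra.Left_Coset"
    "HOL-Algebra.Group_Action"
begin

section \<open>Actions on standard probability spaces\<close>

definition standard_probability_space :: "'x measure \<Rightarrow> bool" where
  "standard_probability_space M \<longleftrightarrow> prob_space M \<and>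
     (\<exists>T. completely_metrizable_space T \<and> second_countable T \<and> topspace T = space M \<and>
          sets M = sigma_sets (topspace T) {U. openin T U})"

text \<open>\<^const>\<open>group_action\<close> makes every \<open>\<sigma> g\<close> an extensional function, i.e. \<open>\<sigma> g\<close> is
  \<^const>\<open>undefined\<close> outside \<open>space M\<close>.\<close>

definition pmp_action ::
    "('g, 'm) monoid_scheme \<Rightarrow> 'x measure \<Rightarrow> ('g \<Rightarrow> 'x \<Rightarrow> 'x) \<Rightarrow> bool" where
  "pmp_action G M \<sigma> \<longleftrightarrow> group_action G (space M) \<sigma> \<and>
     (\<forall>g\<in>carrier G. \<sigma> g \<in> measurable M M \<and> distr M M (\<sigma> g) = M)"

definition orbit_equivalence_relation ::
    "('g, 'm) monoid_scheme \<Rightarrow> 'x measure \<Rightarrow> ('g \<Rightarrow> 'x \<Rightarrow> 'x) \<Rightarrow> ('x \<times> 'x) set" where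
  "orbit_equivalence_relation G M \<sigma> =
     {(x, y). x \<in> space M \<and> y \<in> space M \<and> orbit G \<sigma> x = orbit G \<sigma> y}"


section \<open>Coinduced actions\<close>

definition quotient_section ::
    "('g, 'm) monoid_scheme \<Rightarrow> 'g set \<Rightarrow> ('g set \<Rightarrow> 'g) \<Rightarrow> bool" where
  "quotient_section G S \<phi> \<longleftrightarrow> (\<forall>i\<in>lcosets\<^bsub>G\<^esub> S. \<phi> i \<in> carrier G \<and> \<phi> i <#\<^bsub>G\<^esub> S = i)"

definition section_cocycle ::
    "('g, 'm) monoid_scheme \<Rightarrow> ('g set \<Rightarrow> 'g) \<Rightarrow> 'g \<Rightarrow> 'g set \<Rightarrow> 'g" where
  "section_cocycle G \<phi> g i = inv\<^bsub>G\<^esub> (\<phi> (g <#\<^bsub>G\<^esub> i)) \<otimes>\<^bsub>G\<^esub> g \<otimes>\<^bsub>G\<^esub> \<phi> i"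

definition coinduced_space ::
    "('g, 'm) monoid_scheme \<Rightarrow> 'g set \<Rightarrow> 'x measure \<Rightarrow> ('g set \<Rightarrow> 'x) measure" where
  "coinduced_space G S M0 = PiM (lcosets\<^bsub>G\<^esub> S) (\<lambda>_. M0)"

text \<open>The defining formula prescribes the coordinate of \<open>\<sigma>\<^sub>g x\<close> at \<open>g i\<close>; solved for the
  coordinate at \<open>j\<close>, one has \<open>i = g\<^sup>-\<^sup>1 j\<close>. Lemma \<open>coinduced_action_apply\<close> recovers the
  original form.\<close>

definition coinduced_action ::
    "('g, 'm) monoid_scheme \<Rightarrow> 'g set \<Rightarrow> 'x measure \<Rightarrow> ('g set \<Rightarrow> 'g) \<Rightarrow> ('g \<Rightarrow> 'x \<Rightarrow> 'x)
       \<Rightarrow> 'g \<Rightarrow> ('g set \<Rightarrow> 'x) \<Rightarrow> ('g set \<Rightarrow> 'x)" where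
  "coinduced_action G S M0 \<phi> \<sigma>0 g =
     (\<lambda>x\<in>space (coinduced_space G S M0). \<lambda>j\<in>lcosets\<^bsub>G\<^esub> S.
        let i = inv\<^bsub>G\<^esub> g <#\<^bsub>G\<^esub> j in \<sigma>0 (section_cocycle G \<phi> g i) (x i))"

lemma coinduced_action_apply:
  assumes "group G" "subgroup S G" "g \<in> carrier G" "i \<in> lcosets\<^bsub>G\<^esub> S"
    and "x \<in> space (coinduced_space G S M0)"
  shows "coinduced_action G S M0 \<phi> \<sigma>0 g x (g <#\<^bsub>G\<^esub> i) = \<sigma>0 (section_cocycle G \<phi> g i) (x i)"
proof -
  interpret group G by fact
  have S: "S \<subseteq> carrier G" using assms(2) by (rule subgroup.subset)
  obtain a where a: "a \<in> carrier G" "i = a <#\<^bsub>G\<^esub> S"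
    using assms(4) by (auto simp: LCOSETS_def)
  have i: "i \<subseteq> carrier G" using a S by (auto simp: l_coset_def)
  have "g <#\<^bsub>G\<^esub> i = (g \<otimes>\<^bsub>G\<^esub> a) <#\<^bsub>G\<^esub> S"
    using a S assms(3) by (simp add: lcos_m_assoc)
  then have gi: "g <#\<^bsub>G\<^esub> i \<in> lcosets\<^bsub>G\<^esub> S"
    using a assms(3) by (auto simp: LCOSETS_def)
  have "inv\<^bsub>G\<^esub> g <#\<^bsub>G\<^esub> (g <#\<^bsub>G\<^esub> i) = i"
    using i assms(3) by (simp add: lcos_m_assoc lcos_mult_one)
  then show ?thesis
    using gi assms(5) by (simp add: coinduced_action_def Let_def)
qed


section \<open>Relative amenability\<close>

definition bounded_functions :: "'i set \<Rightarrow> ('i \<Rightarrow> real) set" where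
  "bounded_functions I = {f. bounded (f ` I)}"

text \<open>A mean is a state on \<open>\<ell>\<^sup>\<infinity>(I)\<close>. Linearity and positivity force its values to depend only
  on the restriction of the function to \<open>I\<close>.\<close>

definition is_mean :: "'i set \<Rightarrow> (('i \<Rightarrow> real) \<Rightarrow> real) \<Rightarrow> bool" where
  "is_mean I m \<longleftrightarrow>
     (\<forall>f\<in>bounded_functions I. \<forall>h\<in>bounded_functions I. \<forall>a b.
        m (\<lambda>i. a * f i + b * h i) = a * m f + b * m h) \<and>
     (\<forall>f\<in>bounded_functions I. (\<forall>i\<in>I. 0 \<le> f i) \<longrightarrow> 0 \<le> m f) \<and>
     m (\<lambda>_. 1) = 1"

definition admits_invariant_mean :: "'g set \<Rightarrow> 'i set \<Rightarrow> ('g \<Rightarrow> 'i \<Rightarrow> 'i) \<Rightarrow> bool" where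
  "admits_invariant_mean D I act \<longleftrightarrow>
     (\<exists>m. is_mean I m \<and> (\<forall>g\<in>D. \<forall>f\<in>bounded_functions I. m (\<lambda>i. f (act g i)) = m f))"

definition amenable_relative_to ::
    "('g, 'm) monoid_scheme \<Rightarrow> 'g set \<Rightarrow> 'g set \<Rightarrow> bool" where
  "amenable_relative_to G D S \<longleftrightarrow>
     admits_invariant_mean D (lcosets\<^bsub>G\<^esub> S) (\<lambda>g i. g <#\<^bsub>G\<^esub> i)"


section \<open>Spectral gap\<close>

text \<open>Elements of \<open>L\<^sup>2\<close> are represented by square-integrable functions; no notion below
  distinguishes functions that agree almost everywhere.\<close>

definition L2 :: "'x measure \<Rightarrow> ('x \<Rightarrow> complex) set" where
  "L2 M = {f \<in> borel_measurable M. integrable M (\<lambda>x. (cmod (f x))\<^sup>2)}"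

definition L2_inner :: "'x measure \<Rightarrow> ('x \<Rightarrow> complex) \<Rightarrow> ('x \<Rightarrow> complex) \<Rightarrow> complex" where
  "L2_inner M f h = (LINT x|M. f x * cnj (h x))"

definition L2_norm :: "'x measure \<Rightarrow> ('x \<Rightarrow> complex) \<Rightarrow> real" where
  "L2_norm M f = sqrt (LINT x|M. (cmod (f x))\<^sup>2)"

definition L2_minus_constants :: "'x measure \<Rightarrow> ('x \<Rightarrow> complex) set" where
  "L2_minus_constants M = {f \<in> L2 M. \<forall>c. L2_inner M f (\<lambda>_. c) = 0}"

definition koopman ::
    "('g, 'm) monoid_scheme \<Rightarrow> ('g \<Rightarrow> 'x \<Rightarrow> 'x) \<Rightarrow> 'g \<Rightarrow> ('x \<Rightarrow> complex) \<Rightarrow> 'x \<Rightarrow> complex" where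
  "koopman G \<sigma> g f = (\<lambda>x. f (\<sigma> (inv\<^bsub>G\<^esub> g) x))"

definition spectral_gap ::
    "('g, 'm) monoid_scheme \<Rightarrow> 'x measure \<Rightarrow> ('g \<Rightarrow> 'x \<Rightarrow> 'x) \<Rightarrow> bool" where
  "spectral_gap G M \<sigma> \<longleftrightarrow>
     \<not> (\<exists>\<xi> :: nat \<Rightarrow> 'x \<Rightarrow> complex.
          (\<forall>n. \<xi> n \<in> L2_minus_constants M \<and> L2_norm M (\<xi> n) = 1) \<and>
          (\<forall>g\<in>carrier G. (\<lambda>n. L2_norm M (\<lambda>x. koopman G \<sigma> g (\<xi> n) x - \<xi> n x)) \<longlonglongrightarrow> 0))"


section \<open>Strong ergodicity\<close>

definition pmp_automorphisms :: "'x measure \<Rightarrow> ('x \<Rightarrow> 'x) set" where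
  "pmp_automorphisms M =
     {\<alpha>. bij_betw \<alpha> (space M) (space M) \<and> \<alpha> \<in> measurable M M \<and>
         the_inv_into (space M) \<alpha> \<in> measurable M M \<and> distr M M \<alpha> = M}"

definition full_group :: "'x measure \<Rightarrow> ('x \<times> 'x) set \<Rightarrow> ('x \<Rightarrow> 'x) set" where
  "full_group M R = {\<alpha> \<in> pmp_automorphisms M. AE x in M. (\<alpha> x, x) \<in> R}"

definition strongly_ergodic :: "'x measure \<Rightarrow> ('x \<times> 'x) set \<Rightarrow> bool" where
  "strongly_ergodic M R \<longleftrightarrow>
     (\<forall>A :: nat \<Rightarrow> 'x set.
        (\<forall>n. A n \<in> sets M) \<and>
        (\<forall>\<alpha>\<in>full_group M R. (\<lambda>n. measure M (sym_diff (\<alpha> ` A n) (A n))) \<longlonglongrightarrow> 0) \<longrightarrow>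
        (\<lambda>n. measure M (A n) * (1 - measure M (A n))) \<longlonglongrightarrow> 0)"

end

theory Submission
  imports Defs
begin

text \<open>
  Write \<open>I = \<Gamma>/\<Sigma>\<close>. The space \<open>L\<^sup>2(X\<^sub>0\<^sup>I)\<close> is the orthogonal sum, over the finite subsets
  \<open>F\<close> of \<open>I\<close>, of the spaces of functions that depend on the coordinates in \<open>F\<close> and average to zero in
  each of them. The constants are the summand of the empty set, and the coinduced action of \<open>g\<close> carries
  the summand of \<open>F\<close> to that of \<open>gF\<close>, because it permutes the coordinates by translation, up to
  transformations of the single coordinates. The squares of the norms of the components of a unit vector
  orthogonal to the constants therefore form a probability distribution on the nonempty finite
  subsets of \<open>I\<close>, and spreading the mass of each \<open>F\<close> uniformly over its points gives a probability
  distribution on \<open>I\<close>. This construction is equivariant and continuous, so almost invariant unit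
  vectors give almost invariant distributions on \<open>I\<close>, and a cluster point of these is a \<open>\<Delta>\<close>-invariant
  mean. If \<open>\<Delta>\<close> is not amenable relative to \<open>\<Sigma>\<close>, there are thus no almost invariant unit vectors.

  The decomposition enters only through the squares of the norms. The conditional expectation onto the
  coordinates in \<open>A\<close> collects the components with \<open>F \<subseteq> A\<close>, so these numbers are obtained by Moebius
  inversion (\<open>cross_weight\<close>); that they are nonnegative and add up to the square of the norm is
  \<open>weight_nonneg\<close> and \<open>sum_weight\<close>. Continuity is the Cauchy-Schwarz inequality
  (\<open>weighted_average_almost_invariant\<close>). To have finite sums and everywhere defined conditional
  expectations, the argument runs with bounded real functions of finitely many coordinates, which are
  dense (\<open>cylinder_approx_L2\<close>). The passage to the limit is
  \<open>invariant_mean_of_asymptotically_invariant_means\<close>.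

  Strong ergodicity follows from a spectral gap for every measure preserving action: the centered
  indicators of almost invariant sets are almost invariant vectors
  (\<open>spectral_gap_imp_strongly_ergodic\<close>).
\<close>

section \<open>Invariant means as limits\<close>

lemma bounded_functionsI:
  assumes "\<And>i. i \<in> I \<Longrightarrow> \<bar>f i\<bar> \<le> c"
  shows "f \<in> bounded_functions I"
proof -
  have "\<forall>y\<in>f ` I. norm y \<le> c" using assms by auto
  then show ?thesis unfolding bounded_functions_def bounded_iff by blast
qed

lemma bounded_functions_bound:
  assumes "f \<in> bounded_functions I"
  shows "\<exists>c>0. \<forall>i\<in>I. \<bar>f i\<bar> \<le> c"
proof -
  obtain c where "0 < c" "\<forall>x\<in>f ` I. norm x \<le> c"
    using assms unfolding bounded_functions_def bounded_pos by blast
  then show ?thesis by auto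
qed

lemma
  assumes "is_mean I m"
  shows is_mean_linear: "f \<in> bounded_functions I \<Longrightarrow> h \<in> bounded_functions I \<Longrightarrow>
      m (\<lambda>i. a * f i + b * h i) = a * m f + b * m h"
    and is_mean_nonneg: "f \<in> bounded_functions I \<Longrightarrow> (\<And>i. i \<in> I \<Longrightarrow> 0 \<le> f i) \<Longrightarrow> 0 \<le> m f"
    and is_mean_one: "m (\<lambda>_. 1) = 1"
  using assms unfolding is_mean_def by simp_all

text \<open>Positivity at \<open>c + f\<close> and \<open>c - f\<close>. The bound does not depend on the mean, so that all means lie in
one product of compact intervals.\<close>

lemma mean_abs_le:
  assumes m: "is_mean I m" and c: "\<And>i. i \<in> I \<Longrightarrow> \<bar>f i\<bar> \<le> c"
  shows "\<bar>m f\<bar> \<le> c"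
proof -
  have f: "f \<in> bounded_functions I"
    using c by (rule bounded_functionsI)
  have one: "(\<lambda>_. 1) \<in> bounded_functions I"
    by (rule bounded_functionsI[where c = 1]) simp
  have lin: "m (\<lambda>i. a * f i + b * 1) = a * m f + b" for a b
  proof -
    have "m (\<lambda>i. a * f i + b * 1) = a * m f + b * m (\<lambda>_. 1)"
      using m f one by (rule is_mean_linear)
    moreover have "m (\<lambda>_. 1) = 1"
      using m by (rule is_mean_one)
    ultimately show ?thesis by simp
  qed
  have pos: "0 \<le> m (\<lambda>i. a * f i + c * 1)" if "a = 1 \<or> a = -1" for a
  proof -
    have "\<bar>a * f i + c * 1\<bar> \<le> 2 * c" if "i \<in> I" for i
      using c[OF that] \<open>a = 1 \<or> a = -1\<close> by auto
    then have "(\<lambda>i. a * f i + c * 1) \<in> bounded_functions I"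
      by (rule bounded_functionsI)
    moreover have "0 \<le> a * f i + c * 1" if "i \<in> I" for i
      using c[OF that] \<open>a = 1 \<or> a = -1\<close> by auto
    ultimately show ?thesis
      by (rule is_mean_nonneg[OF m])
  qed
  show ?thesis
    using pos[of 1] pos[of "-1"] lin[of 1 c] lin[of "-1" c] by auto
qed

text \<open>By Tychonoff's theorem a sequence of means, regarded as points of a product of compact intervals
indexed by the bounded functions, has a cluster point for pointwise convergence. Linearity,
positivity, normalization and asymptotic invariance each constrain finitely many coordinates by a
closed condition, hence pass to the cluster point.\<close>

lemma invariant_mean_of_asymptotically_invariant_means:
  fixes m :: "nat \<Rightarrow> ('i \<Rightarrow> real) \<Rightarrow> real"
  assumes mean: "\<And>n. is_mean I (m n)"
    and act: "\<And>g i. g \<in> D \<Longrightarrow> i \<in> I \<Longrightarrow> act g i \<in> I"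
    and inv: "\<And>g f. g \<in> D \<Longrightarrow> f \<in> bounded_functions I \<Longrightarrow>
       (\<lambda>n. m n (\<lambda>i. f (act g i)) - m n f) \<longlonglongrightarrow> 0"
  shows "admits_invariant_mean D I act"
proof -
  define B where "B = bounded_functions I"
  \<comment> \<open>the axioms say nothing about unbounded functions; the value 0 there keeps the sequence
    in the compact set\<close>
  define m' where "m' n f = (if f \<in> B then m n f else 0)" for n f
  define c where "c f = (if f \<in> B then (SOME c. \<forall>i\<in>I. \<bar>f i\<bar> \<le> c) else 0)" for f :: "'i \<Rightarrow> real"
  have c: "\<bar>f i\<bar> \<le> c f" if f: "f \<in> B" and i: "i \<in> I" for f i
  proof -
    have "\<exists>c. \<forall>i\<in>I. \<bar>f i\<bar> \<le> c"
      using bounded_functions_bound f unfolding B_def by blast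
    then have "\<forall>i\<in>I. \<bar>f i\<bar> \<le> (SOME c. \<forall>i\<in>I. \<bar>f i\<bar> \<le> c)"
      by (rule someI_ex)
    then show ?thesis using f i by (simp add: c_def)
  qed
  define K where "K = (PiE UNIV (\<lambda>f. {- c f..c f}))"
  have "compactin (product_topology (\<lambda>_. euclidean) UNIV) K"
    unfolding K_def compactin_PiE by simp
  then have "compact K"
    by (simp add: euclidean_product_topology)
  moreover have "m' n \<in> K" for n
    unfolding K_def
  proof (rule PiE_I)
    fix f
    show "m' n f \<in> {- c f..c f}"
    proof (cases "f \<in> B")
      case True
      then have "\<bar>m n f\<bar> \<le> c f" by (intro mean_abs_le[OF mean] c)
      then show ?thesis using True by (auto simp: m'_def)
    qed (simp add: m'_def c_def)
  qed simp
  then have "eventually (\<lambda>x. x \<in> K) (filtermap m' sequentially)"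
    by (simp add: eventually_filtermap)
  ultimately obtain l where ne: "inf (nhds l) (filtermap m' sequentially) \<noteq> bot"
    unfolding compact_filter by (metis filtermap_bot_iff sequentially_bot)
  define G where "G = inf (nhds l) (filtermap m' sequentially)"
  have G: "G \<noteq> bot" using ne by (simp add: G_def)
  have ev: "eventually P G" if "eventually (\<lambda>n. P (m' n)) sequentially" for P
  proof -
    have "G \<le> filtermap m' sequentially" by (simp add: G_def)
    then show ?thesis using that by (simp add: le_filter_def eventually_filtermap)
  qed
  have lim: "((\<lambda>k. k f) \<longlongrightarrow> l f) G" for f
  proof -
    have "\<forall>\<^sub>F k in G. k f \<in> S" if "open S" "l f \<in> S" for S
    proof -
      have "open ((\<lambda>k :: ('i \<Rightarrow> real) \<Rightarrow> real. k f) -` S)"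
        using continuous_on_product_coordinates[of f] \<open>open S\<close> by (rule open_vimage[rotated])
      then have "\<forall>\<^sub>F k in nhds l. k f \<in> S"
        using \<open>l f \<in> S\<close> unfolding eventually_nhds by blast
      moreover have "G \<le> nhds l" by (simp add: G_def)
      ultimately show ?thesis by (simp add: le_filter_def)
    qed
    then show ?thesis by (rule topological_tendstoI)
  qed
  have closed_B: "(\<lambda>i. a * f i + b * h i) \<in> B" if "f \<in> B" "h \<in> B" for f h a b
  proof -
    have "\<bar>a * f i + b * h i\<bar> \<le> \<bar>a\<bar> * c f + \<bar>b\<bar> * c h" if "i \<in> I" for i
    proof -
      have "\<bar>a * f i + b * h i\<bar> \<le> \<bar>a\<bar> * \<bar>f i\<bar> + \<bar>b\<bar> * \<bar>h i\<bar>"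
        using abs_triangle_ineq[of "a * f i" "b * h i"] by (simp only: abs_mult)
      also have "\<dots> \<le> \<bar>a\<bar> * c f + \<bar>b\<bar> * c h"
        using c[OF \<open>f \<in> B\<close> that] c[OF \<open>h \<in> B\<close> that] by (intro add_mono mult_left_mono) auto
      finally show ?thesis .
    qed
    then show ?thesis unfolding B_def by (rule bounded_functionsI)
  qed
  have one_B: "(\<lambda>_. 1) \<in> B"
    unfolding B_def by (rule bounded_functionsI[where c = 1]) simp
  have act_B: "(\<lambda>i. f (act g i)) \<in> B" if "f \<in> B" "g \<in> D" for f g
    unfolding B_def using act[OF that(2)] c[OF that(1)] by (intro bounded_functionsI[where c = "c f"]) auto
  show ?thesis
    unfolding admits_invariant_mean_def
  proof (intro exI conjI ballI)
    show "is_mean I l"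
      unfolding is_mean_def B_def[symmetric]
    proof (intro conjI ballI allI impI)
      fix f h a b assume fh: "f \<in> B" "h \<in> B"
      have "m n (\<lambda>i. a * f i + b * h i) = a * m n f + b * m n h" for n
        using mean[of n] fh unfolding B_def by (rule is_mean_linear)
      then have "\<forall>\<^sub>F k in G. k (\<lambda>i. a * f i + b * h i) = a * k f + b * k h"
        by (intro ev) (simp add: m'_def fh closed_B)
      then have "((\<lambda>k. a * k f + b * k h) \<longlongrightarrow> l (\<lambda>i. a * f i + b * h i)) G"
        using lim by (rule tendsto_cong[THEN iffD1])
      moreover have "((\<lambda>k. a * k f + b * k h) \<longlongrightarrow> a * l f + b * l h) G"
        by (intro tendsto_intros lim)
      ultimately show "l (\<lambda>i. a * f i + b * h i) = a * l f + b * l h"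
        using G tendsto_unique by blast
    next
      fix f assume f: "f \<in> B" "\<forall>i\<in>I. 0 \<le> f i"
      have "0 \<le> m n f" for n
        using f unfolding B_def by (intro is_mean_nonneg[OF mean[of n]]) auto
      then have "\<forall>\<^sub>F k in G. 0 \<le> k f"
        by (intro ev) (simp add: m'_def f)
      then show "0 \<le> l f"
        using tendsto_lowerbound[OF lim _ G] by blast
    next
      have "m n (\<lambda>_. 1) = 1" for n
        using mean[of n] by (rule is_mean_one)
      then have "\<forall>\<^sub>F k in G. k (\<lambda>_. 1) = 1"
        by (intro ev) (simp add: m'_def one_B)
      then have "((\<lambda>k. 1) \<longlongrightarrow> l (\<lambda>_. 1)) G"
        using lim by (rule tendsto_cong[THEN iffD1])
      then show "l (\<lambda>_. 1) = 1"
        using G tendsto_unique tendsto_const by blast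
    qed
  next
    fix g f assume g: "g \<in> D" and "f \<in> bounded_functions I"
    then have f: "f \<in> B" by (simp add: B_def)
    have "((\<lambda>k. k (\<lambda>i. f (act g i)) - k f) \<longlongrightarrow> 0) G"
    proof (rule tendstoI)
      fix e :: real assume "0 < e"
      then have "\<forall>\<^sub>F n in sequentially. dist (m n (\<lambda>i. f (act g i)) - m n f) 0 < e"
        using inv[OF g] f unfolding B_def by (intro tendstoD) auto
      then show "\<forall>\<^sub>F k in G. dist (k (\<lambda>i. f (act g i)) - k f) 0 < e"
        by (intro ev) (simp add: m'_def f act_B g)
    qed
    moreover have "((\<lambda>k. k (\<lambda>i. f (act g i)) - k f) \<longlongrightarrow> l (\<lambda>i. f (act g i)) - l f) G"
      by (intro tendsto_intros lim)
    ultimately show "l (\<lambda>i. f (act g i)) = l f"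
      using G tendsto_unique by fastforce
  qed
qed

section \<open>Moebius inversion over finite sets\<close>

text \<open>Moebius inversion on the lattice of finite sets: \<open>moebius b\<close> is the function whose sums over the
subsets of \<open>J\<close> recover \<open>b J\<close>.\<close>

definition moebius :: "('i set \<Rightarrow> real) \<Rightarrow> 'i set \<Rightarrow> real" where
  "moebius b F = (\<Sum>A\<in>Pow F. (-1) ^ (card F - card A) * b A)"

lemma sum_moebius:
  assumes "finite J"
  shows "(\<Sum>F\<in>Pow J. moebius b F) = b J"
proof -
  define g where "g F = (\<Sum>A\<in>Pow F. (-1) ^ card A * b A)" for F
  have "moebius b F = (-1) ^ card F * g F" if "F \<subseteq> J" for F
  proof -
    have "finite F" using that assms by (rule finite_subset)
    then have "(-1) ^ (card F - card A) * b A = (-1) ^ card F * ((-1) ^ card A * b A)"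
      if "A \<subseteq> F" for A
      using that by (simp add: card_mono flip: neg_one_power_add_eq_neg_one_power_diff power_add mult.assoc)
    then show ?thesis
      unfolding moebius_def g_def sum_distrib_left by (intro sum.cong) auto
  qed
  moreover have "b J = (\<Sum>F\<in>Pow J. (-1) ^ card F * g F)"
    by (rule inclusion_exclusion_symmetric) (simp_all add: g_def assms)
  ultimately show ?thesis by simp
qed

text \<open>As \<open>b (A \<inter> B)\<close> is the sum of \<open>moebius b D\<close> over the \<open>D \<subseteq> B\<close> that are contained in \<open>A\<close>, its
transform in \<open>B\<close> is \<open>moebius b\<close> cut off outside the subsets of \<open>A\<close>.\<close>

lemma moebius_inter:
  assumes "finite F" "A \<subseteq> F"
  shows "moebius (\<lambda>B. b (A \<inter> B)) F = (if A = F then moebius b F else 0)"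
proof -
  define h where "h D = (if D \<subseteq> A then moebius b D else 0)" for D
  have "b (A \<inter> B) = sum h (Pow B)" if "finite B" for B
  proof -
    have "sum h (Pow B) = (\<Sum>D\<in>Pow (A \<inter> B). moebius b D)"
      unfolding h_def using that by (intro sum.mono_neutral_cong_right) auto
    then show ?thesis using sum_moebius[of "A \<inter> B" b] that by simp
  qed
  then have "h F = (\<Sum>B\<in>Pow F. (-1) ^ (card F - card B) * b (A \<inter> B))"
    using \<open>finite F\<close> by (rule inclusion_exclusion_mobius)
  then have "moebius (\<lambda>B. b (A \<inter> B)) F = h F"
    by (simp add: moebius_def)
  moreover have "F \<subseteq> A \<longleftrightarrow> A = F"
    using \<open>A \<subseteq> F\<close> by blast
  ultimately show ?thesis
    by (simp add: h_def)
qed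

text \<open>For a function \<open>b\<close> such that \<open>b (A \<inter> B)\<close> is the inner product of vectors \<open>e A\<close> and \<open>e B\<close>, the double
sum is the square of the norm of a signed sum of the \<open>e A\<close>; this is how \<open>moebius b F\<close> will be seen to
be nonnegative.\<close>

lemma moebius_double:
  assumes "finite F"
  shows "moebius b F =
    (\<Sum>A\<in>Pow F. \<Sum>B\<in>Pow F. (-1) ^ (card F - card A) * (-1) ^ (card F - card B) * b (A \<inter> B))"
proof -
  have "(\<Sum>B\<in>Pow F. (-1) ^ (card F - card A) * (-1) ^ (card F - card B) * b (A \<inter> B))
      = (if A = F then moebius b F else 0)" if "A \<in> Pow F" for A
  proof -
    have "(\<Sum>B\<in>Pow F. (-1) ^ (card F - card A) * (-1) ^ (card F - card B) * b (A \<inter> B))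
      = (-1) ^ (card F - card A) * moebius (\<lambda>B. b (A \<inter> B)) F"
      by (simp add: moebius_def sum_distrib_left mult.assoc)
    also have "\<dots> = (if A = F then moebius b F else 0)"
      using assms that by (subst moebius_inter) auto
    finally show ?thesis .
  qed
  then have "(\<Sum>A\<in>Pow F. \<Sum>B\<in>Pow F.
        (-1) ^ (card F - card A) * (-1) ^ (card F - card B) * b (A \<inter> B))
      = (\<Sum>A\<in>Pow F. if A = F then moebius b F else 0)"
    by (rule sum.cong[OF refl])
  also have "\<dots> = moebius b F"
    using assms by (simp add: sum.delta)
  finally show ?thesis by simp
qed

lemma moebius_linear:
  "moebius (\<lambda>A. r * b A + s * c A) F = r * moebius b F + s * moebius c F"
  by (simp add: moebius_def distrib_left sum.distrib sum_distrib_left mult.left_commute)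

lemma moebius_image:
  assumes "inj_on p F"
  shows "moebius b (p ` F) = moebius (\<lambda>A. b (p ` A)) F"
proof -
  have "inj_on ((`) p) (Pow F)"
    using assms by (simp add: inj_on_image_Pow)
  moreover have "card (p ` A) = card A" if "A \<subseteq> F" for A
    using inj_on_subset[OF assms that] by (rule card_image)
  ultimately show ?thesis
    using card_image[OF assms]
    by (auto simp: moebius_def sum.reindex image_Pow_surj[OF refl, of p F, symmetric] intro!: sum.cong)
qed

lemma moebius_cong: "(\<And>A. A \<subseteq> F \<Longrightarrow> b A = c A) \<Longrightarrow> moebius b F = moebius c F"
  unfolding moebius_def by (intro sum.cong) auto

section \<open>Conditional expectations on product spaces\<close>

locale iid_product = product_prob_space "\<lambda>_. N" I
  for N :: "'x measure" and I :: "'i set"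
begin

abbreviation M :: "('i \<Rightarrow> 'x) measure" where "M \<equiv> PiM I (\<lambda>_. N)"

definition mix :: "'i set \<Rightarrow> ('i \<Rightarrow> 'x) \<Rightarrow> ('i \<Rightarrow> 'x) \<Rightarrow> ('i \<Rightarrow> 'x)" where
  "mix A x y = (\<lambda>i\<in>I. if i \<in> A then x i else y i)"

text \<open>The conditional expectation given the coordinates in \<open>A\<close>: the other coordinates are replaced by
independent ones and averaged out. The integral formula gives a version that is defined at every
point and satisfies the identities below without exceptional null sets.\<close>

definition resample :: "'i set \<Rightarrow> (('i \<Rightarrow> 'x) \<Rightarrow> real) \<Rightarrow> ('i \<Rightarrow> 'x) \<Rightarrow> real" where
  "resample A f x = (LINT y|M. f (mix A x y))"

definition bounded_measurable :: "(('i \<Rightarrow> 'x) \<Rightarrow> real) set" where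
  "bounded_measurable = {f \<in> borel_measurable M. \<exists>c. \<forall>x\<in>space M. \<bar>f x\<bar> \<le> c}"

lemma space_M: "x \<in> space M \<longleftrightarrow> (\<forall>i\<in>I. x i \<in> space N) \<and> x \<in> extensional I"
  by (auto simp: space_PiM PiE_def)

lemma mix_in_space: "x \<in> space M \<Longrightarrow> y \<in> space M \<Longrightarrow> mix A x y \<in> space M"
  by (auto simp: space_M mix_def)

lemma measurable_mix [measurable]: "(\<lambda>(x, y). mix A x y) \<in> M \<Otimes>\<^sub>M M \<rightarrow>\<^sub>M M"
  unfolding mix_def case_prod_beta
proof (rule measurable_restrict)
  fix i assume "i \<in> I"
  then show "(\<lambda>z. if i \<in> A then fst z i else snd z i) \<in> M \<Otimes>\<^sub>M M \<rightarrow>\<^sub>M N"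
    by (cases "i \<in> A") simp_all
qed

lemma measurable_mix_right [measurable]: "x \<in> space M \<Longrightarrow> mix A x \<in> M \<rightarrow>\<^sub>M M"
  using measurable_compose[OF measurable_Pair1' measurable_mix, of x A] by simp

lemma bounded_measurable_borel: "f \<in> bounded_measurable \<Longrightarrow> f \<in> borel_measurable M"
  by (simp add: bounded_measurable_def)

lemma bounded_measurableI:
  "f \<in> borel_measurable M \<Longrightarrow> (\<And>x. x \<in> space M \<Longrightarrow> \<bar>f x\<bar> \<le> c) \<Longrightarrow> f \<in> bounded_measurable"
  unfolding bounded_measurable_def by blast

lemma bounded_measurable_bound:
  assumes "f \<in> bounded_measurable"
  shows "\<exists>c\<ge>0. \<forall>x\<in>space M. \<bar>f x\<bar> \<le> c"
proof -
  obtain c where "\<forall>x\<in>space M. \<bar>f x\<bar> \<le> c"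
    using assms unfolding bounded_measurable_def by blast
  then have "\<forall>x\<in>space M. \<bar>f x\<bar> \<le> \<bar>c\<bar>" by fastforce
  then show ?thesis using abs_ge_zero by blast
qed

lemma bounded_measurable_integrable:
  assumes "f \<in> bounded_measurable"
  shows "integrable M f"
  using bounded_measurable_bound[OF assms] bounded_measurable_borel[OF assms]
  by (elim exE conjE) (auto intro!: P.integrable_const_bound AE_I2)

lemma bounded_measurable_linear:
  assumes "f \<in> bounded_measurable" "h \<in> bounded_measurable"
  shows "(\<lambda>x. a * f x + b * h x) \<in> bounded_measurable"
proof -
  obtain c where "0 \<le> c" and c: "\<forall>x\<in>space M. \<bar>f x\<bar> \<le> c"
    using assms(1)[THEN bounded_measurable_bound] by blast
  note c = c[rule_format]
  obtain d where "0 \<le> d" and d: "\<forall>x\<in>space M. \<bar>h x\<bar> \<le> d"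
    using assms(2)[THEN bounded_measurable_bound] by blast
  note d = d[rule_format]
  show ?thesis
  proof (rule bounded_measurableI)
    show "(\<lambda>x. a * f x + b * h x) \<in> borel_measurable M"
      using assms[THEN bounded_measurable_borel] by simp
    fix x assume x: "x \<in> space M"
    have "\<bar>a * f x + b * h x\<bar> \<le> \<bar>a\<bar> * \<bar>f x\<bar> + \<bar>b\<bar> * \<bar>h x\<bar>"
      using abs_triangle_ineq[of "a * f x" "b * h x"] by (simp only: abs_mult)
    also have "\<dots> \<le> \<bar>a\<bar> * c + \<bar>b\<bar> * d"
      using c[OF x] d[OF x] by (intro add_mono mult_left_mono) auto
    finally show "\<bar>a * f x + b * h x\<bar> \<le> \<bar>a\<bar> * c + \<bar>b\<bar> * d" .
  qed
qed

lemma bounded_measurable_mult: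
  assumes "f \<in> bounded_measurable" "h \<in> bounded_measurable"
  shows "(\<lambda>x. f x * h x) \<in> bounded_measurable"
proof -
  obtain c where "0 \<le> c" and c: "\<forall>x\<in>space M. \<bar>f x\<bar> \<le> c"
    using assms(1)[THEN bounded_measurable_bound] by blast
  note c = c[rule_format]
  obtain d where "0 \<le> d" and d: "\<forall>x\<in>space M. \<bar>h x\<bar> \<le> d"
    using assms(2)[THEN bounded_measurable_bound] by blast
  note d = d[rule_format]
  show ?thesis
  proof (rule bounded_measurableI)
    show "(\<lambda>x. f x * h x) \<in> borel_measurable M"
      using assms[THEN bounded_measurable_borel] by simp
    show "\<bar>f x * h x\<bar> \<le> c * d" if "x \<in> space M" for x
      unfolding abs_mult using c[OF that] d[OF that] \<open>0 \<le> c\<close> by (intro mult_mono) auto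
  qed
qed

lemma bounded_measurable_compose:
  assumes "f \<in> bounded_measurable" "\<tau> \<in> M \<rightarrow>\<^sub>M M"
  shows "(\<lambda>x. f (\<tau> x)) \<in> bounded_measurable"
proof -
  obtain c where "0 \<le> c" and c: "\<forall>x\<in>space M. \<bar>f x\<bar> \<le> c"
    using assms(1)[THEN bounded_measurable_bound] by blast
  note c = c[rule_format]
  show ?thesis
  proof (rule bounded_measurableI)
    show "(\<lambda>x. f (\<tau> x)) \<in> borel_measurable M"
      using assms(2) bounded_measurable_borel[OF assms(1)] by (rule measurable_compose)
    show "\<bar>f (\<tau> x)\<bar> \<le> c" if "x \<in> space M" for x
      using c measurable_space[OF assms(2) that] by blast
  qed
qed

text \<open>A box constrains the coordinates in \<open>A\<close> through the first sample and the others through the second,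
and the samples are independent.\<close>

lemma distr_mix: "distr (M \<Otimes>\<^sub>M M) M (\<lambda>(x, y). mix A x y) = M"
proof (rule PiM_eq)
  fix J F assume J: "finite J" "J \<subseteq> I" and F: "\<And>j. j \<in> J \<Longrightarrow> F j \<in> sets N"
  let ?E = "\<lambda>K. prod_emb I (\<lambda>_. N) K (\<Pi>\<^sub>E j\<in>K. F j)"
  have E: "?E K \<in> sets M" if "K \<subseteq> J" for K
    using that J F by (intro sets_PiM_I) (auto intro: finite_subset)
  have "emeasure (distr (M \<Otimes>\<^sub>M M) M (\<lambda>(x, y). mix A x y)) (?E J)
      = emeasure (M \<Otimes>\<^sub>M M) ((\<lambda>(x, y). mix A x y) -` ?E J \<inter> space (M \<Otimes>\<^sub>M M))"
    using E by (intro emeasure_distr) auto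
  also have "(\<lambda>(x, y). mix A x y) -` ?E J \<inter> space (M \<Otimes>\<^sub>M M) = ?E (J \<inter> A) \<times> ?E (J - A)"
    using J F[THEN sets.sets_into_space]
    by (fastforce simp: prod_emb_def space_pair_measure space_M mix_def PiE_iff split: if_splits)
  also have "emeasure (M \<Otimes>\<^sub>M M) \<dots> = emeasure M (?E (J \<inter> A)) * emeasure M (?E (J - A))"
    using E by (intro P.emeasure_pair_measure_Times) auto
  also have "\<dots> = (\<Prod>j\<in>J \<inter> A. emeasure N (F j)) * (\<Prod>j\<in>J - A. emeasure N (F j))"
    using J F by (subst (1 2) emeasure_PiM_emb) auto
  also have "\<dots> = (\<Prod>j\<in>J. emeasure N (F j))"
    using J by (simp add: prod.Int_Diff[of J _ A])
  finally show "emeasure (distr (M \<Otimes>\<^sub>M M) M (\<lambda>(x, y). mix A x y)) (?E J)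
     = (\<Prod>j\<in>J. emeasure N (F j))" .
qed simp

lemma integral_mix:
  assumes f: "f \<in> bounded_measurable"
  shows "(LINT x|M. LINT y|M. f (mix A x y)) = (LINT x|M. f x)"
proof -
  interpret MM: pair_prob_space M M ..
  obtain c where "0 \<le> c" and c: "\<forall>x\<in>space M. \<bar>f x\<bar> \<le> c"
    using f[THEN bounded_measurable_bound] by blast
  note c = c[rule_format]
  have fm: "f \<in> borel_measurable M" using f by (rule bounded_measurable_borel)
  have m: "(\<lambda>z. f (case z of (x, y) \<Rightarrow> mix A x y)) \<in> borel_measurable (M \<Otimes>\<^sub>M M)"
    using measurable_mix fm by (rule measurable_compose)
  have "integrable (M \<Otimes>\<^sub>M M) (\<lambda>z. f (case z of (x, y) \<Rightarrow> mix A x y))"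
    by (rule MM.P.integrable_const_bound[where B = c])
       (use m c mix_in_space in \<open>auto simp: space_pair_measure\<close>)
  then have i: "integrable (M \<Otimes>\<^sub>M M) (\<lambda>(x, y). f (mix A x y))"
    by (simp add: case_prod_unfold)
  have "(LINT x|M. f x) = (LINT x|(distr (M \<Otimes>\<^sub>M M) M (\<lambda>(x, y). mix A x y)). f x)"
    by (simp add: distr_mix)
  also have "\<dots> = (LINT z|(M \<Otimes>\<^sub>M M). f (case z of (x, y) \<Rightarrow> mix A x y))"
    using fm by (intro integral_distr) auto
  also have "\<dots> = (LINT z|(M \<Otimes>\<^sub>M M). (case z of (x, y) \<Rightarrow> f (mix A x y)))"
    by (simp add: case_prod_unfold)
  also have "\<dots> = (LINT x|M. LINT y|M. f (mix A x y))"
    using MM.integral_fst'[OF i] by simp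
  finally show ?thesis by simp
qed

lemma bounded_measurable_mix:
  assumes "f \<in> bounded_measurable" "x \<in> space M"
  shows "(\<lambda>y. f (mix A x y)) \<in> bounded_measurable"
  using assms(1) measurable_mix_right[OF assms(2)] by (rule bounded_measurable_compose)

lemma resample_bounded_measurable:
  assumes f: "f \<in> bounded_measurable"
  shows "resample A f \<in> bounded_measurable"
proof -
  obtain c where "0 \<le> c" and c: "\<forall>x\<in>space M. \<bar>f x\<bar> \<le> c"
    using f[THEN bounded_measurable_bound] by blast
  note c = c[rule_format]
  have fm: "f \<in> borel_measurable M" using f by (rule bounded_measurable_borel)
  have m: "(\<lambda>z. f (case z of (x, y) \<Rightarrow> mix A x y)) \<in> borel_measurable (M \<Otimes>\<^sub>M M)"
    using measurable_mix fm by (rule measurable_compose)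
  show ?thesis
  proof (rule bounded_measurableI)
    have "(\<lambda>(x, y). f (mix A x y)) \<in> borel_measurable (M \<Otimes>\<^sub>M M)"
      using m by (simp add: case_prod_unfold)
    then show "resample A f \<in> borel_measurable M"
      unfolding resample_def by (rule P.borel_measurable_lebesgue_integral)
    fix x assume x: "x \<in> space M"
    have "\<bar>resample A f x\<bar> \<le> (LINT y|M. \<bar>f (mix A x y)\<bar>)"
      unfolding resample_def by (rule integral_abs_bound)
    also have "\<dots> \<le> (LINT y|M. c)"
      using bounded_measurable_integrable[OF bounded_measurable_mix[OF f x]] x c
      by (intro integral_mono) (auto intro: mix_in_space)
    also have "\<dots> = c" by (simp add: P.prob_space)
    finally show "\<bar>resample A f x\<bar> \<le> c" .
  qed
qed

text \<open>Composing the two operations keeps the coordinates in \<open>A \<inter> B\<close>; the remaining ones come from the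
first or from the second new sample, and \<open>distr_mix\<close> allows to merge the two samples into one.\<close>

lemma resample_resample:
  assumes f: "f \<in> bounded_measurable" and x: "x \<in> space M"
  shows "resample A (resample B f) x = resample (A \<inter> B) f x"
proof -
  have "mix B (mix A x y) z = mix (A \<inter> B) x (mix B y z)" for y z
    by (auto simp: mix_def)
  then have "resample A (resample B f) x = (LINT y|M. LINT z|M. f (mix (A \<inter> B) x (mix B y z)))"
    by (simp add: resample_def)
  also have "\<dots> = resample (A \<inter> B) f x"
    unfolding resample_def by (rule integral_mix) (rule bounded_measurable_mix[OF f x])
  finally show ?thesis .
qed

text \<open>\<open>resample A f\<close> is constant along the coordinates that \<open>resample A\<close> averages out, and averaging
preserves the integral. Hence \<open>resample A\<close> is symmetric.\<close>

lemma integral_resample_mult: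
  assumes f: "f \<in> bounded_measurable" and h: "h \<in> bounded_measurable"
  shows "(LINT x|M. resample A f x * h x) = (LINT x|M. resample A f x * resample A h x)"
proof -
  have Ef: "resample A f \<in> bounded_measurable" using f by (rule resample_bounded_measurable)
  have "resample A f (mix A x y) = resample A f x" for x y
  proof -
    have "mix A (mix A x y) z = mix A x z" for z by (auto simp: mix_def)
    then show ?thesis by (simp add: resample_def)
  qed
  then have "(LINT x|M. resample A f x * resample A h x)
      = (LINT x|M. LINT y|M. resample A f (mix A x y) * h (mix A x y))"
    by (simp add: resample_def)
  also have "\<dots> = (LINT x|M. resample A f x * h x)"
    by (rule integral_mix) (rule bounded_measurable_mult[OF Ef h])
  finally show ?thesis by simp
qed

end

section \<open>Weights of the Hoeffding decomposition\<close>

context iid_product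
begin

definition resample_form :: "'i set \<Rightarrow> (('i \<Rightarrow> 'x) \<Rightarrow> real) \<Rightarrow> (('i \<Rightarrow> 'x) \<Rightarrow> real) \<Rightarrow> real" where
  "resample_form A u v = (LINT x|M. resample A u x * v x)"

text \<open>Let \<open>P F\<close> be the orthogonal projection onto the functions that depend on the coordinates in \<open>F\<close>
and average to zero in each of them (the Hoeffding decomposition). Since \<open>resample A\<close> is the sum of
the \<open>P F\<close> with \<open>F \<subseteq> A\<close>, Moebius inversion identifies \<open>cross_weight F u v\<close> with the inner product of
\<open>P F u\<close> and \<open>P F v\<close>.\<close>

definition cross_weight :: "'i set \<Rightarrow> (('i \<Rightarrow> 'x) \<Rightarrow> real) \<Rightarrow> (('i \<Rightarrow> 'x) \<Rightarrow> real) \<Rightarrow> real" where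
  "cross_weight F u v = moebius (\<lambda>A. resample_form A u v) F"

abbreviation weight :: "'i set \<Rightarrow> (('i \<Rightarrow> 'x) \<Rightarrow> real) \<Rightarrow> real" where
  "weight F u \<equiv> cross_weight F u u"

lemma resample_form_commute:
  assumes "u \<in> bounded_measurable" "v \<in> bounded_measurable"
  shows "resample_form A u v = resample_form A v u"
  unfolding resample_form_def
  using integral_resample_mult[OF assms, of A] integral_resample_mult[OF assms(2,1), of A]
  by (simp add: mult.commute)

text \<open>The operators \<open>resample A\<close> and \<open>resample B\<close> commute with product \<open>resample (A \<inter> B)\<close>, which can be
moved to the two sides of the inner product by symmetry.\<close>

lemma resample_form_inter:
  assumes u: "u \<in> bounded_measurable" and v: "v \<in> bounded_measurable"
  shows "resample_form (A \<inter> B) u v = (LINT x|M. resample A u x * resample B v x)"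
proof -
  have Eu: "resample A u \<in> bounded_measurable" using u by (rule resample_bounded_measurable)
  have "resample_form (A \<inter> B) u v = resample_form B (resample A u) v"
    unfolding resample_form_def
    by (rule Bochner_Integration.integral_cong) (simp_all add: resample_resample[OF u] Int_commute)
  also have "\<dots> = resample_form B v (resample A u)"
    using Eu v by (rule resample_form_commute)
  finally show ?thesis by (simp add: resample_form_def mult.commute)
qed

lemma resample_form_linear_right:
  assumes "u \<in> bounded_measurable" "v \<in> bounded_measurable" "w \<in> bounded_measurable"
  shows "resample_form A u (\<lambda>x. a * v x + b * w x) = a * resample_form A u v + b * resample_form A u w"
proof -
  have E: "resample A u \<in> bounded_measurable" using assms(1) by (rule resample_bounded_measurable)
  have i: "integrable M (\<lambda>x. resample A u x * v x)" "integrable M (\<lambda>x. resample A u x * w x)"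
    using assms E by (auto intro: bounded_measurable_integrable bounded_measurable_mult)
  have "resample_form A u (\<lambda>x. a * v x + b * w x)
      = (LINT x|M. a * (resample A u x * v x) + b * (resample A u x * w x))"
    by (simp add: resample_form_def algebra_simps)
  also have "\<dots> = a * resample_form A u v + b * resample_form A u w"
    using i by (simp add: resample_form_def)
  finally show ?thesis .
qed

lemma cross_weight_commute:
  assumes "u \<in> bounded_measurable" "v \<in> bounded_measurable"
  shows "cross_weight F u v = cross_weight F v u"
  by (simp add: cross_weight_def resample_form_commute[OF assms])

lemma cross_weight_linear_right:
  assumes "u \<in> bounded_measurable" "v \<in> bounded_measurable" "w \<in> bounded_measurable"
  shows "cross_weight F u (\<lambda>x. a * v x + b * w x) = a * cross_weight F u v + b * cross_weight F u w"
  by (simp add: cross_weight_def resample_form_linear_right[OF assms] moebius_linear)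

text \<open>By \<open>moebius_double\<close> the weight is the integral of the square of the alternating sum of the functions
\<open>resample A u\<close> with \<open>A \<subseteq> F\<close>.\<close>

lemma weight_nonneg:
  assumes u: "u \<in> bounded_measurable" and "finite F"
  shows "0 \<le> weight F u"
proof -
  let ?e = "\<lambda>A. (-1) ^ (card F - card A) :: real"
  have i: "integrable M (\<lambda>x. resample A u x * resample B u x)" for A B
    by (intro bounded_measurable_integrable bounded_measurable_mult resample_bounded_measurable u)
  have "weight F u
      = (\<Sum>A\<in>Pow F. \<Sum>B\<in>Pow F. ?e A * ?e B * (LINT x|M. resample A u x * resample B u x))"
    unfolding cross_weight_def moebius_double[OF \<open>finite F\<close>] resample_form_inter[OF u u] ..
  also have "\<dots> = (LINT x|M. (\<Sum>A\<in>Pow F. \<Sum>B\<in>Pow F. ?e A * ?e B * (resample A u x * resample B u x)))"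
    using i by (simp add: Bochner_Integration.integral_sum)
  also have "\<dots> = (LINT x|M. (\<Sum>A\<in>Pow F. ?e A * resample A u x)\<^sup>2)"
    by (simp add: power2_eq_square sum_product mult_ac)
  also have "\<dots> \<ge> 0" by simp
  finally show ?thesis .
qed

text \<open>The Cauchy-Schwarz inequality for the positive form \<open>cross_weight F\<close>. The free parameter \<open>s\<close> makes
the bound linear in the weights, so that it can be summed over \<open>F\<close> without a second application.\<close>

lemma cross_weight_le:
  assumes u: "u \<in> bounded_measurable" and v: "v \<in> bounded_measurable" and F: "finite F" and s: "0 < s"
  shows "\<bar>cross_weight F u v\<bar> \<le> (s * weight F u + weight F v / s) / 2"
proof -
  have "0 \<le> s\<^sup>2 * weight F u + 2 * s * (r * cross_weight F u v) + weight F v" if "r = 1 \<or> r = -1" for r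
  proof -
    let ?w = "\<lambda>x. s * u x + r * v x"
    have w: "?w \<in> bounded_measurable" using u v by (rule bounded_measurable_linear)
    have "weight F ?w = s * cross_weight F u ?w + r * cross_weight F v ?w"
      using cross_weight_linear_right[OF w u v] cross_weight_commute[OF w u] cross_weight_commute[OF w v]
      by simp
    also have "\<dots> = s * (s * weight F u + r * cross_weight F u v)
        + r * (s * cross_weight F u v + r * weight F v)"
      using cross_weight_linear_right[OF u u v] cross_weight_linear_right[OF v u v]
        cross_weight_commute[OF u v] by simp
    also have "\<dots> = s\<^sup>2 * weight F u + 2 * s * (r * cross_weight F u v) + (r * r) * weight F v"
      by (simp add: power2_eq_square algebra_simps)
    also have "r * r = 1" using that by auto
    finally show ?thesis
      using weight_nonneg[OF w F] by simp
  qed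
  from this[of 1] this[of "-1"]
  have "2 * s * \<bar>cross_weight F u v\<bar> \<le> s\<^sup>2 * weight F u + weight F v" by (auto simp: abs_if)
  then show ?thesis
    using s by (simp add: field_simps power2_eq_square)
qed

lemma weight_diff:
  assumes u: "u \<in> bounded_measurable" and v: "v \<in> bounded_measurable"
  shows "weight F u - weight F v = cross_weight F (\<lambda>x. u x - v x) (\<lambda>x. u x + v x)"
proof -
  have lin: "(\<lambda>x. u x - v x) \<in> bounded_measurable"
    using bounded_measurable_linear[OF u v, of 1 "-1"] by simp
  have r: "cross_weight F w (\<lambda>x. u x + v x) = cross_weight F w u + cross_weight F w v"
    if "w \<in> bounded_measurable" for w
    using cross_weight_linear_right[OF that u v, of F 1 1] by simp
  have l: "cross_weight F (\<lambda>x. u x - v x) w = cross_weight F u w - cross_weight F v w"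
    if "w \<in> bounded_measurable" for w
    using cross_weight_linear_right[OF that u v, of F 1 "-1"]
      cross_weight_commute[OF that u] cross_weight_commute[OF that v] cross_weight_commute[OF that lin]
    by simp
  show ?thesis
    by (simp add: r[OF lin] l[OF u] l[OF v] cross_weight_commute[OF u v])
qed

lemma weight_empty:
  assumes "u \<in> bounded_measurable"
  shows "weight {} u = (LINT x|M. u x)\<^sup>2"
proof -
  have "resample {} u x = (LINT y|M. u y)" for x
    unfolding resample_def
  proof (rule Bochner_Integration.integral_cong[OF refl])
    fix y assume "y \<in> space M"
    then have "mix {} x y = y" by (auto simp: mix_def space_M extensional_def)
    then show "u (mix {} x y) = u y" by simp
  qed
  then show ?thesis
    by (simp add: cross_weight_def moebius_def resample_form_def power2_eq_square)
qed

definition depends_only_on :: "'i set \<Rightarrow> (('i \<Rightarrow> 'x) \<Rightarrow> real) \<Rightarrow> bool" where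
  "depends_only_on J h \<longleftrightarrow> (\<forall>x\<in>space M. \<forall>y\<in>space M. (\<forall>i\<in>J. x i = y i) \<longrightarrow> h x = h y)"

lemma resample_depends_only_on:
  assumes "depends_only_on J h" "J \<subseteq> I" "x \<in> space M"
  shows "resample J h x = h x"
proof -
  have "resample J h x = (LINT y|M. h x)"
    unfolding resample_def
  proof (rule Bochner_Integration.integral_cong[OF refl])
    fix y assume "y \<in> space M"
    moreover have "\<forall>i\<in>J. mix J x y i = x i" using assms(2) by (auto simp: mix_def)
    ultimately show "h (mix J x y) = h x"
      using assms mix_in_space unfolding depends_only_on_def by blast
  qed
  then show ?thesis by (simp add: P.prob_space)
qed

text \<open>Pythagoras: for a function of the coordinates in \<open>J\<close> the components indexed by subsets of \<open>J\<close>
exhaust the norm.\<close>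

lemma sum_weight:
  assumes "depends_only_on J h" "J \<subseteq> I" "finite J"
  shows "(\<Sum>F\<in>Pow J. weight F h) = (LINT x|M. (h x)\<^sup>2)"
proof -
  have "(\<Sum>F\<in>Pow J. weight F h) = resample_form J h h"
    unfolding cross_weight_def by (rule sum_moebius[OF assms(3)])
  also have "\<dots> = (LINT x|M. (h x)\<^sup>2)"
    unfolding resample_form_def
    by (rule Bochner_Integration.integral_cong)
       (simp_all add: resample_depends_only_on[OF assms(1,2)] power2_eq_square)
  finally show ?thesis .
qed

lemma depends_only_on_mono: "depends_only_on J h \<Longrightarrow> J \<subseteq> K \<Longrightarrow> depends_only_on K h"
  unfolding depends_only_on_def by blast

text \<open>The sums of the nonnegative weights over the subsets of \<open>J\<close> and over those of \<open>J \<union> F\<close> both equal the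
square of the norm, so that the additional terms vanish.\<close>

lemma weight_eq_0:
  assumes h: "h \<in> bounded_measurable" "depends_only_on J h" and "J \<subseteq> I" "finite J"
    and "F \<subseteq> I" "finite F" "\<not> F \<subseteq> J"
  shows "weight F h = 0"
proof -
  let ?K = "J \<union> F"
  have "(\<Sum>G\<in>Pow ?K. weight G h) = (LINT x|M. (h x)\<^sup>2)"
    using assms by (intro sum_weight depends_only_on_mono[OF h(2)]) auto
  moreover have "(\<Sum>G\<in>Pow J. weight G h) = (LINT x|M. (h x)\<^sup>2)"
    using assms by (intro sum_weight)
  moreover have "(\<Sum>G\<in>Pow ?K. weight G h) = (\<Sum>G\<in>Pow J. weight G h) + (\<Sum>G\<in>Pow ?K - Pow J. weight G h)"
    using assms by (intro sum.subset_diff[THEN trans[OF _ add.commute]]) auto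
  ultimately have "(\<Sum>G\<in>Pow ?K - Pow J. weight G h) = 0" by simp
  moreover have "\<forall>G\<in>Pow ?K - Pow J. 0 \<le> weight G h"
    using assms by (auto intro!: weight_nonneg[OF h(1)] intro: finite_subset[of _ ?K])
  ultimately have "\<forall>G\<in>Pow ?K - Pow J. weight G h = 0"
    using assms by (subst (asm) sum_nonneg_eq_0_iff) auto
  then show ?thesis using assms by blast
qed

text \<open>A measure preserving transformation whose output at \<open>j\<close> is determined by the input at \<open>p j\<close>. The
elements of the group act on a coinduced space in this way.\<close>

definition coordinate_map :: "('i \<Rightarrow> 'i) \<Rightarrow> (('i \<Rightarrow> 'x) \<Rightarrow> ('i \<Rightarrow> 'x)) \<Rightarrow> bool" where
  "coordinate_map p \<tau> \<longleftrightarrow> \<tau> \<in> M \<rightarrow>\<^sub>M M \<and> distr M M \<tau> = M \<and> inj_on p I \<and> p ` I \<subseteq> I \<and>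
     (\<forall>x\<in>space M. \<forall>y\<in>space M. \<forall>j\<in>I. x (p j) = y (p j) \<longrightarrow> \<tau> x j = \<tau> y j)"

context
  fixes p \<tau> assumes p\<tau>: "coordinate_map p \<tau>"
begin

lemma coordinate_map_measurable: "\<tau> \<in> M \<rightarrow>\<^sub>M M"
  and coordinate_map_distr: "distr M M \<tau> = M"
  and coordinate_map_inj: "inj_on p I"
  and coordinate_map_range: "p ` I \<subseteq> I"
  and coordinate_map_cong: "x \<in> space M \<Longrightarrow> y \<in> space M \<Longrightarrow> j \<in> I \<Longrightarrow> x (p j) = y (p j) \<Longrightarrow> \<tau> x j = \<tau> y j"
  using p\<tau> unfolding coordinate_map_def by blast+

lemma coordinate_map_in_space: "x \<in> space M \<Longrightarrow> \<tau> x \<in> space M"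
  using coordinate_map_measurable by (rule measurable_space)

lemma coordinate_map_integral:
  assumes "f \<in> borel_measurable M"
  shows "(LINT x|M. f (\<tau> x)) = (LINT x|M. f x :: real)"
  using integral_distr[OF coordinate_map_measurable assms] by (simp add: coordinate_map_distr)

lemma coordinate_map_mix:
  assumes "x \<in> space M" "y \<in> space M" "A \<subseteq> I"
  shows "\<tau> (mix (p ` A) x y) = mix A (\<tau> x) (\<tau> y)"
proof
  fix j
  have m: "mix (p ` A) x y \<in> space M" using assms by (intro mix_in_space)
  show "\<tau> (mix (p ` A) x y) j = mix A (\<tau> x) (\<tau> y) j"
  proof (cases "j \<in> I")
    case True
    then have "p j \<in> I" using coordinate_map_range by blast
    moreover have "p j \<in> p ` A \<longleftrightarrow> j \<in> A"
      using coordinate_map_inj True assms(3) by (meson inj_on_image_mem_iff)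
    ultimately show ?thesis
      using True coordinate_map_cong[OF m assms(1) True] coordinate_map_cong[OF m assms(2) True]
      by (simp add: mix_def)
  next
    case False
    then show ?thesis
      using coordinate_map_in_space[OF m] by (auto simp: mix_def space_M extensional_def)
  qed
qed

lemma resample_compose:
  assumes f: "f \<in> bounded_measurable" and x: "x \<in> space M" and A: "A \<subseteq> I"
  shows "resample (p ` A) (\<lambda>x. f (\<tau> x)) x = resample A f (\<tau> x)"
proof -
  have "resample (p ` A) (\<lambda>x. f (\<tau> x)) x = (LINT y|M. f (mix A (\<tau> x) (\<tau> y)))"
    unfolding resample_def
    by (rule Bochner_Integration.integral_cong) (simp_all add: coordinate_map_mix[OF x _ A])
  also have "\<dots> = resample A f (\<tau> x)"
    unfolding resample_def
    using bounded_measurable_borel[OF bounded_measurable_mix[OF f coordinate_map_in_space[OF x]]]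
    by (rule coordinate_map_integral)
  finally show ?thesis .
qed

lemma weight_compose:
  assumes f: "f \<in> bounded_measurable" and F: "F \<subseteq> I"
  shows "weight (p ` F) (\<lambda>x. f (\<tau> x)) = weight F f"
proof -
  have "resample_form (p ` A) (\<lambda>x. f (\<tau> x)) (\<lambda>x. f (\<tau> x)) = resample_form A f f" if "A \<subseteq> I" for A
  proof -
    have "resample_form (p ` A) (\<lambda>x. f (\<tau> x)) (\<lambda>x. f (\<tau> x))
        = (LINT x|M. (\<lambda>x. resample A f x * f x) (\<tau> x))"
      unfolding resample_form_def
      by (rule Bochner_Integration.integral_cong) (simp_all add: resample_compose[OF f _ that])
    also have "\<dots> = resample_form A f f"
      unfolding resample_form_def
      using bounded_measurable_borel[OF bounded_measurable_mult[OF resample_bounded_measurable[OF f] f]]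
      by (rule coordinate_map_integral)
    finally show ?thesis .
  qed
  then show ?thesis
    using F unfolding cross_weight_def moebius_image[OF inj_on_subset[OF coordinate_map_inj F]]
    by (intro moebius_cong) auto
qed

lemma depends_only_on_compose:
  assumes "depends_only_on J h" "J \<subseteq> I"
  shows "depends_only_on (p ` J) (\<lambda>x. h (\<tau> x))"
  unfolding depends_only_on_def
proof (intro ballI impI)
  fix x y assume x: "x \<in> space M" and y: "y \<in> space M" and "\<forall>i\<in>p ` J. x i = y i"
  then have "\<forall>i\<in>J. \<tau> x i = \<tau> y i"
    using coordinate_map_cong[OF x y] assms(2) by blast
  then show "h (\<tau> x) = h (\<tau> y)"
    using assms(1) coordinate_map_in_space[OF x] coordinate_map_in_space[OF y]
    unfolding depends_only_on_def by blast
qed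

end

definition average :: "'i set \<Rightarrow> ('i \<Rightarrow> real) \<Rightarrow> real" where
  "average F \<phi> = (\<Sum>i\<in>F. \<phi> i) / card F"

text \<open>The weight of each \<open>F\<close> is spread uniformly over the points of \<open>F\<close>. The average over the empty set
has the value 0, so that the constant component of \<open>h\<close> does not contribute.\<close>

definition weighted_average :: "'i set \<Rightarrow> (('i \<Rightarrow> 'x) \<Rightarrow> real) \<Rightarrow> ('i \<Rightarrow> real) \<Rightarrow> real" where
  "weighted_average J h \<phi> = (\<Sum>F\<in>Pow J. weight F h * average F \<phi>)"

lemma average_abs_le:
  assumes "\<And>i. i \<in> F \<Longrightarrow> \<bar>\<phi> i\<bar> \<le> c" "0 \<le> c"
  shows "\<bar>average F \<phi>\<bar> \<le> c"
proof (cases "card F = 0")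
  case False
  have "\<bar>\<Sum>i\<in>F. \<phi> i\<bar> \<le> (\<Sum>i\<in>F. c)"
    using assms by (intro order_trans[OF sum_abs] sum_mono)
  then show ?thesis
    using False by (simp add: average_def divide_le_eq mult.commute)
qed (simp add: average_def assms)

lemma weighted_average_enlarge:
  assumes "h \<in> bounded_measurable" "depends_only_on J h" "J \<subseteq> K" "K \<subseteq> I" "finite K"
  shows "weighted_average J h \<phi> = weighted_average K h \<phi>"
  unfolding weighted_average_def
proof (rule sum.mono_neutral_left)
  show "\<forall>F\<in>Pow K - Pow J. weight F h * average F \<phi> = 0"
    using assms by (auto intro!: weight_eq_0[OF assms(1,2)] intro: finite_subset[of _ K])
qed (use assms in auto)

text \<open>The total mass is the variance of \<open>h\<close>: all weights but that of the empty set count.\<close>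

lemma weighted_average_one:
  assumes "h \<in> bounded_measurable" "depends_only_on J h" "J \<subseteq> I" "finite J"
  shows "weighted_average J h (\<lambda>_. 1) = (LINT x|M. (h x)\<^sup>2) - (LINT x|M. h x)\<^sup>2"
proof -
  have "weighted_average J h (\<lambda>_. 1) = (\<Sum>F\<in>Pow J. weight F h - (if F = {} then weight F h else 0))"
    unfolding weighted_average_def
  proof (rule sum.cong[OF refl])
    fix F assume "F \<in> Pow J"
    then have "finite F" using assms(4) by (auto intro: finite_subset)
    then show "weight F h * average F (\<lambda>_. 1) = weight F h - (if F = {} then weight F h else 0)"
      by (simp add: average_def)
  qed
  also have "\<dots> = (LINT x|M. (h x)\<^sup>2) - (LINT x|M. h x)\<^sup>2"
    using assms by (simp add: sum_subtractf sum_weight weight_empty[OF assms(1), symmetric])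
  finally show ?thesis .
qed

lemma is_mean_weighted_average:
  assumes h: "h \<in> bounded_measurable" "depends_only_on J h" and J: "J \<subseteq> I" "finite J"
    and pos: "0 < weighted_average J h (\<lambda>_. 1)"
  shows "is_mean I (\<lambda>\<phi>. weighted_average J h \<phi> / weighted_average J h (\<lambda>_. 1))"
  unfolding is_mean_def
proof (intro conjI ballI allI impI)
  have lin: "average F (\<lambda>i. a * \<phi> i + b * \<psi> i) = a * average F \<phi> + b * average F \<psi>" for F a b \<phi> \<psi>
    by (simp add: average_def sum.distrib add_divide_distrib flip: sum_distrib_left)
  show "weighted_average J h (\<lambda>i. a * \<phi> i + b * \<psi> i) / weighted_average J h (\<lambda>_. 1)
      = a * (weighted_average J h \<phi> / weighted_average J h (\<lambda>_. 1))
      + b * (weighted_average J h \<psi> / weighted_average J h (\<lambda>_. 1))" for \<phi> \<psi> a b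
    by (simp add: weighted_average_def lin distrib_left sum.distrib add_divide_distrib sum_distrib_left
        mult.left_commute)
  show "0 \<le> weighted_average J h \<phi> / weighted_average J h (\<lambda>_. 1)" if "\<forall>i\<in>I. 0 \<le> \<phi> i" for \<phi>
  proof -
    have "0 \<le> average F \<phi>" if "F \<subseteq> J" for F
      unfolding average_def using that J \<open>\<forall>i\<in>I. 0 \<le> \<phi> i\<close> by (intro divide_nonneg_nonneg sum_nonneg) auto
    then have "0 \<le> weighted_average J h \<phi>"
      unfolding weighted_average_def using J
      by (intro sum_nonneg mult_nonneg_nonneg weight_nonneg[OF h(1)]) (auto intro: finite_subset)
    then show ?thesis using pos by simp
  qed
  show "weighted_average J h (\<lambda>_. 1) / weighted_average J h (\<lambda>_. 1) = 1"
    using pos by simp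
qed

lemma weighted_average_compose:
  assumes p\<tau>: "coordinate_map p \<tau>" and h: "h \<in> bounded_measurable" "depends_only_on J h"
    and J: "J \<subseteq> I" "finite J"
  shows "weighted_average J h (\<lambda>i. \<phi> (p i)) = weighted_average (p ` J) (\<lambda>x. h (\<tau> x)) \<phi>"
proof -
  have inj: "inj_on p J" using coordinate_map_inj[OF p\<tau>] J(1) by (rule inj_on_subset)
  have "weight F h * average F (\<lambda>i. \<phi> (p i)) = weight (p ` F) (\<lambda>x. h (\<tau> x)) * average (p ` F) \<phi>"
    if "F \<subseteq> J" for F
  proof -
    have injF: "inj_on p F" using inj that by (rule inj_on_subset)
    show ?thesis
      using weight_compose[OF p\<tau> h(1), of F] that J
      by (auto simp: average_def card_image[OF injF] sum.reindex[OF injF])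
  qed
  then have "weighted_average J h (\<lambda>i. \<phi> (p i))
      = (\<Sum>F\<in>Pow J. (\<lambda>F. weight F (\<lambda>x. h (\<tau> x)) * average F \<phi>) (p ` F))"
    unfolding weighted_average_def by (intro sum.cong) auto
  also have "\<dots> = (\<Sum>F\<in>(`) p ` Pow J. weight F (\<lambda>x. h (\<tau> x)) * average F \<phi>)"
    using inj by (intro sum.reindex[unfolded o_def, symmetric]) (simp add: inj_on_image_Pow)
  also have "(`) p ` Pow J = Pow (p ` J)"
    by (rule image_Pow_surj) simp
  finally show ?thesis by (simp add: weighted_average_def)
qed

text \<open>Translating the argument by \<open>p\<close> has the same effect as replacing \<open>h\<close> by \<open>h \<circ> \<tau>\<close>. The two families of
weights differ by the cross weights of \<open>u = h \<circ> \<tau> - h\<close> and \<open>v = h \<circ> \<tau> + h\<close>, whose absolute values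
are summed by \<open>cross_weight_le\<close> and \<open>sum_weight\<close>.\<close>

lemma weighted_average_almost_invariant:
  assumes p\<tau>: "coordinate_map p \<tau>" and h: "h \<in> bounded_measurable" "depends_only_on J h"
    and J: "J \<subseteq> I" "finite J"
    and \<phi>: "\<And>i. i \<in> I \<Longrightarrow> \<bar>\<phi> i\<bar> \<le> c" "0 \<le> c" and s: "0 < s"
  shows "\<bar>weighted_average J h (\<lambda>i. \<phi> (p i)) - weighted_average J h \<phi>\<bar>
    \<le> c * (s * (LINT x|M. (h (\<tau> x) - h x)\<^sup>2) + 4 * (LINT x|M. (h x)\<^sup>2) / s) / 2"
proof -
  let ?k = "\<lambda>x. h (\<tau> x)" let ?K = "J \<union> p ` J"
  let ?u = "\<lambda>x. h (\<tau> x) - h x" let ?v = "\<lambda>x. h (\<tau> x) + h x"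
  have K: "?K \<subseteq> I" "finite ?K" using J coordinate_map_range[OF p\<tau>] by auto
  have k: "?k \<in> bounded_measurable"
    using h(1) coordinate_map_measurable[OF p\<tau>] by (rule bounded_measurable_compose)
  have kJ: "depends_only_on (p ` J) ?k" using p\<tau> h(2) J(1) by (rule depends_only_on_compose)
  have u: "?u \<in> bounded_measurable" using bounded_measurable_linear[OF k h(1), of 1 "-1"] by simp
  have v: "?v \<in> bounded_measurable" using bounded_measurable_linear[OF k h(1), of 1 1] by simp
  have hK: "depends_only_on ?K h" using h(2) by (rule depends_only_on_mono) simp
  have kK: "depends_only_on ?K ?k" using kJ by (rule depends_only_on_mono) simp
  have uvK: "depends_only_on ?K ?u" "depends_only_on ?K ?v"
    using hK kK unfolding depends_only_on_def by metis+
  have int: "integrable M (\<lambda>x. (f x)\<^sup>2)" if "f \<in> bounded_measurable" for f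
    using bounded_measurable_integrable[OF bounded_measurable_mult[OF that that]]
    by (simp add: power2_eq_square)
  have "weighted_average J h (\<lambda>i. \<phi> (p i)) = weighted_average ?K ?k \<phi>"
    unfolding weighted_average_compose[OF p\<tau> h J]
    using k kJ by (rule weighted_average_enlarge) (use K in auto)
  moreover have "weighted_average J h \<phi> = weighted_average ?K h \<phi>"
    using h by (rule weighted_average_enlarge) (use K in auto)
  ultimately have "\<bar>weighted_average J h (\<lambda>i. \<phi> (p i)) - weighted_average J h \<phi>\<bar>
      = \<bar>\<Sum>F\<in>Pow ?K. cross_weight F ?u ?v * average F \<phi>\<bar>"
    by (simp add: weighted_average_def weight_diff[OF k h(1), symmetric] left_diff_distrib sum_subtractf)
  also have "\<dots> \<le> (\<Sum>F\<in>Pow ?K. \<bar>cross_weight F ?u ?v * average F \<phi>\<bar>)"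
    by (rule sum_abs)
  also have "\<dots> \<le> (\<Sum>F\<in>Pow ?K. (s * weight F ?u + weight F ?v / s) / 2 * c)"
  proof (rule sum_mono)
    fix F assume "F \<in> Pow ?K"
    then have F: "finite F" "F \<subseteq> I" using K by (auto intro: finite_subset)
    have "\<bar>average F \<phi>\<bar> \<le> c" using F \<phi> by (intro average_abs_le) auto
    with cross_weight_le[OF u v F(1) s]
    show "\<bar>cross_weight F ?u ?v * average F \<phi>\<bar> \<le> (s * weight F ?u + weight F ?v / s) / 2 * c"
      unfolding abs_mult by (intro mult_mono) auto
  qed
  also have "\<dots> = c * (s * (\<Sum>F\<in>Pow ?K. weight F ?u) + (\<Sum>F\<in>Pow ?K. weight F ?v) / s) / 2"
    unfolding sum_distrib_left sum_divide_distrib sum.distrib[symmetric]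
    by (rule sum.cong) (simp_all add: field_simps)
  also have "\<dots> = c * (s * (LINT x|M. (?u x)\<^sup>2) + (LINT x|M. (?v x)\<^sup>2) / s) / 2"
    using uvK K by (simp only: sum_weight)
  also have "\<dots> \<le> c * (s * (LINT x|M. (?u x)\<^sup>2) + 4 * (LINT x|M. (h x)\<^sup>2) / s) / 2"
  proof -
    have "(LINT x|M. (?v x)\<^sup>2) \<le> (LINT x|M. 2 * (?k x)\<^sup>2 + 2 * (h x)\<^sup>2)"
    proof (rule integral_mono)
      fix x
      show "(?v x)\<^sup>2 \<le> 2 * (?k x)\<^sup>2 + 2 * (h x)\<^sup>2"
        using zero_le_power2[of "?k x - h x"] by (simp add: power2_eq_square algebra_simps)
    qed (use int[OF v] int[OF k] int[OF h(1)] in auto)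
    also have "\<dots> = 2 * (LINT x|M. (?k x)\<^sup>2) + 2 * (LINT x|M. (h x)\<^sup>2)"
      using int[OF k] int[OF h(1)] by simp
    also have "(LINT x|M. (?k x)\<^sup>2) = (LINT x|M. (h x)\<^sup>2)"
      using coordinate_map_integral[OF p\<tau>, of "\<lambda>x. (h x)\<^sup>2"] bounded_measurable_borel[OF h(1)] by simp
    finally show ?thesis
      using s \<phi>(2) by (intro divide_right_mono mult_left_mono add_left_mono) auto
  qed
  finally show ?thesis .
qed

end

section \<open>Density of functions of finitely many coordinates\<close>

context iid_product
begin

text \<open>The sets with this property form a \<open>\<sigma>\<close>-algebra that contains the boxes. For a countable union, all but
finitely many of the sets are dropped at the cost of \<open>e / 2\<close> and the others are approximated within
\<open>e / 2\<close> altogether.\<close>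

lemma cylinder_approx_set:
  assumes "S \<in> sets M" "0 < e"
  shows "\<exists>J C. finite J \<and> J \<subseteq> I \<and> C \<in> sets M \<and> depends_only_on J (indicator C) \<and>
    measure M (sym_diff S C) < e"
proof -
  have "S \<in> sigma_sets (\<Pi>\<^sub>E i\<in>I. space N) (prod_algebra I (\<lambda>_. N))"
    using assms(1) by (simp add: sets_PiM)
  then show ?thesis
    using assms(2)
  proof (induction arbitrary: e rule: sigma_sets.induct)
    case (Basic S)
    obtain J E where S: "S = prod_emb I (\<lambda>_. N) J (\<Pi>\<^sub>E j\<in>J. E j)" and J: "finite J" "J \<subseteq> I"
      and E: "\<And>j. j \<in> J \<Longrightarrow> E j \<in> sets N"
      by (rule prod_algebraE[OF Basic.hyps]) blast
    have "S \<in> sets M" unfolding S using J E by (intro sets_PiM_I) auto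
    moreover have "depends_only_on J (indicator S)"
    proof -
      have "x \<in> S \<longleftrightarrow> (\<forall>j\<in>J. x j \<in> E j)" if "x \<in> space M" for x
        using that J unfolding S by (auto simp: prod_emb_def space_M PiE_iff)
      then show ?thesis by (auto simp: depends_only_on_def indicator_def)
    qed
    ultimately show ?case
      using J Basic.prems by (intro exI[of _ J] exI[of _ S]) simp_all
  next
    case Empty
    show ?case
      using Empty.prems by (intro exI[of _ "{}"]) (simp add: depends_only_on_def)
  next
    case (Compl S)
    obtain J C where JC: "finite J" "J \<subseteq> I" "C \<in> sets M" "depends_only_on J (indicator C)"
      "measure M (sym_diff S C) < e"
      using Compl.IH[OF Compl.prems] by (elim exE conjE)
    have "S \<in> sets M" using Compl.hyps by (simp add: sets_PiM)
    then have "S \<subseteq> space M" "C \<subseteq> space M" using JC(3) sets.sets_into_space by blast+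
    then have "sym_diff ((\<Pi>\<^sub>E i\<in>I. space N) - S) (space M - C) = sym_diff S C"
      by (auto simp: space_PiM)
    moreover have "depends_only_on J (indicator (space M - C))"
      using JC(4) by (auto simp: depends_only_on_def indicator_def split: if_splits)
    ultimately show ?case
      using JC by (intro exI[of _ J] exI[of _ "space M - C"]) auto
  next
    case (Union a)
    have a: "a i \<in> sets M" for i using Union.hyps by (simp add: sets_PiM)
    let ?U = "\<lambda>n. \<Union>i<n. a i" let ?S = "\<Union>i. a i"
    have "(\<lambda>n. measure M (?U n)) \<longlonglongrightarrow> measure M (\<Union>n. ?U n)"
      using a by (intro P.finite_Lim_measure_incseq) (auto simp: incseq_def intro: less_le_trans)
    moreover have "(\<Union>n. ?U n) = ?S" by auto
    ultimately have "(\<lambda>n. measure M (?U n)) \<longlonglongrightarrow> measure M ?S" by simp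
    then have "\<forall>\<^sub>F n in sequentially. measure M ?S - e / 2 < measure M (?U n)"
      by (rule order_tendstoD(1)) (use Union.prems in linarith)
    then obtain n where n: "measure M ?S - e / 2 < measure M (?U n)"
      by (auto simp: eventually_sequentially)
    have rest: "measure M (?S - ?U n) < e / 2"
      using n a by (subst P.finite_measure_Diff) auto
    define d where "d = e / (2 * (real n + 1))"
    have d: "0 < d" "n * d \<le> e / 2" using Union.prems by (auto simp: d_def field_simps)
    have "\<forall>i. \<exists>J C. finite J \<and> J \<subseteq> I \<and> C \<in> sets M \<and> depends_only_on J (indicator C) \<and>
        measure M (sym_diff (a i) C) < d"
      using Union.IH d(1) by blast
    then obtain J C where JC: "\<And>i. finite (J i)" "\<And>i. J i \<subseteq> I" "\<And>i. C i \<in> sets M"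
      "\<And>i. depends_only_on (J i) (indicator (C i))" "\<And>i. measure M (sym_diff (a i) (C i)) < d"
      by metis
    let ?J = "\<Union>i<n. J i" let ?C = "\<Union>i<n. C i"
    have "depends_only_on ?J (indicator ?C)"
      unfolding depends_only_on_def
    proof (intro ballI impI)
      fix x y assume xy: "x \<in> space M" "y \<in> space M" "\<forall>i\<in>?J. x i = y i"
      have "x \<in> C i \<longleftrightarrow> y \<in> C i" if "i < n" for i
      proof -
        have "(indicator (C i) x :: real) = indicator (C i) y"
          using JC(4)[of i] xy that unfolding depends_only_on_def by blast
        then show ?thesis by (cases "x \<in> C i"; cases "y \<in> C i") simp_all
      qed
      then show "(indicator ?C x :: real) = indicator ?C y"
        by (auto simp: indicator_def)
    qed
    moreover have "measure M (sym_diff ?S ?C) < e"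
    proof -
      have "measure M (sym_diff ?S ?C)
          \<le> measure M ((?S - ?U n) \<union> (\<Union>i<n. sym_diff (a i) (C i)))"
        using a JC(3) by (intro P.finite_measure_mono) (auto intro!: sets.finite_UN sets.countable_UN)
      also have "\<dots> \<le> measure M (?S - ?U n) + measure M (\<Union>i<n. sym_diff (a i) (C i))"
        using a JC(3) by (intro measure_Un_le) auto
      also have "measure M (\<Union>i<n. sym_diff (a i) (C i)) \<le> (\<Sum>i<n. measure M (sym_diff (a i) (C i)))"
        using a JC(3) by (intro P.finite_measure_subadditive_finite) auto
      also have "\<dots> \<le> (\<Sum>i<n. d)" using JC(5) by (intro sum_mono) (simp add: less_imp_le)
      also have "\<dots> \<le> e / 2" using d(2) by simp
      finally show ?thesis using rest by simp
    qed
    ultimately show ?case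
      using JC(1-3) by (intro exI[of _ ?J] exI[of _ ?C]) auto
  qed
qed

lemma depends_only_on_compose_left: "depends_only_on J h \<Longrightarrow> depends_only_on J (\<lambda>x. g (h x))"
  unfolding depends_only_on_def by metis

lemma depends_only_on_add:
  "depends_only_on J h \<Longrightarrow> depends_only_on K k \<Longrightarrow> depends_only_on (J \<union> K) (\<lambda>x. h x + k x)"
  unfolding depends_only_on_def by (metis UnCI)

lemma cylinder_approx_L1:
  fixes f :: "('i \<Rightarrow> 'x) \<Rightarrow> real"
  assumes "integrable M f" "0 < e"
  shows "\<exists>J h. finite J \<and> J \<subseteq> I \<and> h \<in> bounded_measurable \<and> depends_only_on J h \<and>
    (LINT x|M. \<bar>f x - h x\<bar>) < e"
  using assms
proof (induction arbitrary: e rule: integrable_induct)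
  case (base S c)
  obtain J C where JC: "finite J" "J \<subseteq> I" "C \<in> sets M" "depends_only_on J (indicator C)"
    "measure M (sym_diff S C) < e / (\<bar>c\<bar> + 1)"
    using cylinder_approx_set[OF base(1), of "e / (\<bar>c\<bar> + 1)"] base(3) by auto
  have "(LINT x|M. \<bar>indicator S x *\<^sub>R c - indicator C x * c\<bar>)
      = (LINT x|M. \<bar>c\<bar> * indicator (sym_diff S C) x)"
    by (rule Bochner_Integration.integral_cong) (auto simp: indicator_def)
  also have "\<dots> = \<bar>c\<bar> * measure M (sym_diff S C)"
    using base(1) JC(3) by simp
  also have "\<dots> \<le> (\<bar>c\<bar> + 1) * measure M (sym_diff S C)"
    by (intro mult_right_mono) auto
  also have "\<dots> < e"
    using JC(5) by (simp add: pos_less_divide_eq mult.commute)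
  finally have "(LINT x|M. \<bar>indicator S x *\<^sub>R c - indicator C x * c\<bar>) < e" .
  moreover have "(\<lambda>x. indicator C x * c) \<in> bounded_measurable"
    using JC(3) by (intro bounded_measurableI[where c = "\<bar>c\<bar>"]) (auto simp: indicator_def)
  moreover have "depends_only_on J (\<lambda>x. indicator C x * c)"
    using JC(4) by (rule depends_only_on_compose_left)
  ultimately show ?case using JC(1,2) by blast
next
  case (add f g)
  from add.IH(1)[of "e / 2"] add.prems obtain J h where
    h: "finite J" "J \<subseteq> I" "h \<in> bounded_measurable" "depends_only_on J h" "(LINT x|M. \<bar>f x - h x\<bar>) < e / 2"
    by auto
  from add.IH(2)[of "e / 2"] add.prems obtain K k where
    k: "finite K" "K \<subseteq> I" "k \<in> bounded_measurable" "depends_only_on K k" "(LINT x|M. \<bar>g x - k x\<bar>) < e / 2"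
    by auto
  have i: "integrable M f" "integrable M g" "integrable M h" "integrable M k"
    using add.hyps h(3) k(3) bounded_measurable_integrable by auto
  have "(LINT x|M. \<bar>(f x + g x) - (h x + k x)\<bar>) \<le> (LINT x|M. \<bar>f x - h x\<bar> + \<bar>g x - k x\<bar>)"
    using i by (intro integral_mono) auto
  also have "\<dots> = (LINT x|M. \<bar>f x - h x\<bar>) + (LINT x|M. \<bar>g x - k x\<bar>)"
    using i by (intro Bochner_Integration.integral_add) auto
  also have "\<dots> < e" using h(5) k(5) by simp
  finally have "(LINT x|M. \<bar>(f x + g x) - (h x + k x)\<bar>) < e" .
  moreover have "(\<lambda>x. h x + k x) \<in> bounded_measurable"
    using bounded_measurable_linear[OF h(3) k(3), of 1 1] by simp
  ultimately show ?case
    using h(1,2) k(1,2) depends_only_on_add[OF h(4) k(4)]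
    by (intro exI[of _ "J \<union> K"] exI[of _ "\<lambda>x. h x + k x"]) auto
next
  case (lim f s)
  have "(\<lambda>n. LINT x|M. \<bar>f x - s n x\<bar>) \<longlonglongrightarrow> (LINT x|M. 0)"
  proof (rule integral_dominated_convergence[where w = "\<lambda>x. 3 * \<bar>f x\<bar>"])
    show "AE x in M. (\<lambda>n. \<bar>f x - s n x\<bar>) \<longlonglongrightarrow> 0"
    proof (rule AE_I2)
      fix x assume "x \<in> space M"
      from tendsto_diff[OF tendsto_const[of "f x"] lim.hyps(2)[OF this]]
      show "(\<lambda>n. \<bar>f x - s n x\<bar>) \<longlonglongrightarrow> 0" by (intro tendsto_rabs_zero) simp
    qed
    show "AE x in M. norm \<bar>f x - s n x\<bar> \<le> 3 * \<bar>f x\<bar>" for n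
      using lim.hyps(3)[of _ n] by (intro AE_I2) (force simp: abs_le_iff)
  qed (use lim.hyps in auto)
  then have "(\<lambda>n. LINT x|M. \<bar>f x - s n x\<bar>) \<longlonglongrightarrow> 0" by simp
  then have "\<forall>\<^sub>F n in sequentially. (LINT x|M. \<bar>f x - s n x\<bar>) < e / 2"
    by (rule order_tendstoD(2)) (use lim.prems in simp)
  then obtain n where n: "(LINT x|M. \<bar>f x - s n x\<bar>) < e / 2"
    by (auto simp: eventually_sequentially)
  from lim.IH[of "e / 2" n] lim.prems obtain J h where
    h: "finite J" "J \<subseteq> I" "h \<in> bounded_measurable" "depends_only_on J h" "(LINT x|M. \<bar>s n x - h x\<bar>) < e / 2"
    by auto
  have i: "integrable M f" "integrable M (s n)" "integrable M h"
    using lim.hyps h(3) bounded_measurable_integrable by auto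
  have "(LINT x|M. \<bar>f x - h x\<bar>) \<le> (LINT x|M. \<bar>f x - s n x\<bar> + \<bar>s n x - h x\<bar>)"
    using i by (intro integral_mono) auto
  also have "\<dots> = (LINT x|M. \<bar>f x - s n x\<bar>) + (LINT x|M. \<bar>s n x - h x\<bar>)"
    using i by (intro Bochner_Integration.integral_add) auto
  also have "\<dots> < e" using h(5) n by simp
  finally show ?case using h(1-4) by blast
qed

definition clip :: "real \<Rightarrow> real \<Rightarrow> real" where
  "clip k t = max (- k) (min t k)"

text \<open>Truncation reduces the claim to bounded \<open>f\<close>. Truncating the approximation in mean as well keeps the
error bounded, and then the integral of its square is controlled by that of its absolute value.\<close>

lemma cylinder_approx_L2:
  fixes f :: "('i \<Rightarrow> 'x) \<Rightarrow> real"
  assumes f: "f \<in> borel_measurable M" "integrable M (\<lambda>x. (f x)\<^sup>2)" and "0 < e"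
  shows "\<exists>J h. finite J \<and> J \<subseteq> I \<and> h \<in> bounded_measurable \<and> depends_only_on J h \<and>
    integrable M (\<lambda>x. (f x - h x)\<^sup>2) \<and> (LINT x|M. (f x - h x)\<^sup>2) < e"
proof -
  have clip_meas [measurable]: "clip k \<in> borel_measurable borel" for k
    unfolding clip_def by measurable
  have clip_bdd: "(\<lambda>x. clip k (u x)) \<in> bounded_measurable" if "u \<in> borel_measurable M" "0 \<le> k" for k u
  proof (rule bounded_measurableI)
    show "(\<lambda>x. clip k (u x)) \<in> borel_measurable M" using that by measurable
    show "\<bar>clip k (u x)\<bar> \<le> k" for x using that by (auto simp: clip_def)
  qed
  have "(\<lambda>n. LINT x|M. (f x - clip (real n) (f x))\<^sup>2) \<longlonglongrightarrow> (LINT x|M. 0)"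
  proof (rule integral_dominated_convergence[where w = "\<lambda>x. (f x)\<^sup>2"])
    show "AE x in M. (\<lambda>n. (f x - clip (real n) (f x))\<^sup>2) \<longlonglongrightarrow> 0"
    proof (rule AE_I2, rule tendsto_eventually)
      fix x
      obtain m where "\<bar>f x\<bar> \<le> real m" using real_arch_simple by blast
      then show "\<forall>\<^sub>F n in sequentially. (f x - clip (real n) (f x))\<^sup>2 = 0"
        by (intro eventually_sequentiallyI[of m]) (auto simp: clip_def)
    qed
    show "AE x in M. norm ((f x - clip (real n) (f x))\<^sup>2) \<le> (f x)\<^sup>2" for n
    proof (rule AE_I2)
      fix x
      have "\<bar>f x - clip (real n) (f x)\<bar> \<le> \<bar>f x\<bar>" by (auto simp: clip_def)
      then show "norm ((f x - clip (real n) (f x))\<^sup>2) \<le> (f x)\<^sup>2"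
        using abs_le_square_iff by auto
    qed
  qed (use f in measurable)
  then have "(\<lambda>n. LINT x|M. (f x - clip (real n) (f x))\<^sup>2) \<longlonglongrightarrow> 0" by simp
  then have "\<forall>\<^sub>F n in sequentially. (LINT x|M. (f x - clip (real n) (f x))\<^sup>2) < e / 4"
    by (rule order_tendstoD(2)) (use \<open>0 < e\<close> in simp)
  then obtain n where n: "(LINT x|M. (f x - clip (real n) (f x))\<^sup>2) < e / 4"
    by (auto simp: eventually_sequentially)
  \<comment> \<open>the additional 1 makes \<open>k\<close> positive, as \<open>n\<close> may be 0\<close>
  define k where "k = real n + 1"
  define g where "g x = clip (real n) (f x)" for x
  have g: "g \<in> bounded_measurable" unfolding g_def using f(1) by (intro clip_bdd) auto
  obtain J h where h: "finite J" "J \<subseteq> I" "h \<in> bounded_measurable" "depends_only_on J h"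
    "(LINT x|M. \<bar>g x - h x\<bar>) < e / (8 * k)"
    using cylinder_approx_L1[OF bounded_measurable_integrable[OF g], of "e / (8 * k)"] \<open>0 < e\<close>
    by (auto simp: k_def)
  define c where "c x = clip k (h x)" for x
  have c: "c \<in> bounded_measurable"
    unfolding c_def using h(3) by (intro clip_bdd) (auto simp: k_def bounded_measurable_borel)
  have i_gc: "integrable M (\<lambda>x. (g x - c x)\<^sup>2)"
    using bounded_measurable_linear[OF g c, of 1 "-1"] bounded_measurable_integrable bounded_measurable_mult
    by (simp add: power2_eq_square)
  have i_fg: "integrable M (\<lambda>x. (f x - g x)\<^sup>2)"
  proof (rule Bochner_Integration.integrable_bound[OF f(2)])
    show "(\<lambda>x. (f x - g x)\<^sup>2) \<in> borel_measurable M"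
      using f(1) g[THEN bounded_measurable_borel] by measurable
    have "\<bar>f x - g x\<bar> \<le> \<bar>f x\<bar>" for x by (auto simp: g_def clip_def)
    then show "AE x in M. norm ((f x - g x)\<^sup>2) \<le> norm ((f x)\<^sup>2)"
      using abs_le_square_iff by (intro AE_I2) auto
  qed
  have le: "(f x - c x)\<^sup>2 \<le> 2 * (f x - g x)\<^sup>2 + 2 * (g x - c x)\<^sup>2" for x
    using zero_le_power2[of "(f x - g x) - (g x - c x)"] by (simp add: power2_eq_square algebra_simps)
  have i_fc: "integrable M (\<lambda>x. (f x - c x)\<^sup>2)"
  proof (rule Bochner_Integration.integrable_bound)
    show "integrable M (\<lambda>x. 2 * (f x - g x)\<^sup>2 + 2 * (g x - c x)\<^sup>2)"
      using i_fg i_gc by auto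
    show "(\<lambda>x. (f x - c x)\<^sup>2) \<in> borel_measurable M"
      using f(1) c[THEN bounded_measurable_borel] by measurable
    show "AE x in M. norm ((f x - c x)\<^sup>2) \<le> norm (2 * (f x - g x)\<^sup>2 + 2 * (g x - c x)\<^sup>2)"
      using le by (intro AE_I2) simp
  qed
  have "(LINT x|M. (f x - c x)\<^sup>2) \<le> (LINT x|M. 2 * (f x - g x)\<^sup>2 + 2 * (g x - c x)\<^sup>2)"
    using i_fc i_fg i_gc le by (intro integral_mono) auto
  also have "\<dots> = 2 * (LINT x|M. (f x - g x)\<^sup>2) + 2 * (LINT x|M. (g x - c x)\<^sup>2)"
    using i_fg i_gc by simp
  also have "(LINT x|M. (g x - c x)\<^sup>2) \<le> (LINT x|M. 2 * k * \<bar>g x - h x\<bar>)"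
  proof (rule integral_mono[OF i_gc])
    show "integrable M (\<lambda>x. 2 * k * \<bar>g x - h x\<bar>)"
      using bounded_measurable_integrable[OF g] bounded_measurable_integrable[OF h(3)] by auto
    fix x
    have "\<bar>g x - c x\<bar> \<le> 2 * k"
      by (simp add: g_def c_def clip_def k_def)
    moreover have "\<bar>g x - c x\<bar> \<le> \<bar>g x - h x\<bar>"
      unfolding g_def c_def clip_def k_def by linarith
    ultimately have "\<bar>g x - c x\<bar> * \<bar>g x - c x\<bar> \<le> 2 * k * \<bar>g x - h x\<bar>"
      by (intro mult_mono) (auto simp: k_def)
    then show "(g x - c x)\<^sup>2 \<le> 2 * k * \<bar>g x - h x\<bar>"
      by (simp add: power2_eq_square flip: abs_mult)
  qed
  also have "\<dots> = 2 * k * (LINT x|M. \<bar>g x - h x\<bar>)" by simp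
  also have "\<dots> < e / 4"
    using h(5) by (simp add: k_def field_simps)
  finally have "(LINT x|M. (f x - c x)\<^sup>2) < e"
    using n by (simp add: g_def)
  moreover have "depends_only_on J c"
    unfolding c_def using h(4) by (rule depends_only_on_compose_left)
  ultimately show ?thesis using h(1,2) c i_fc by blast
qed

end

section \<open>Invariant means from almost invariant functions\<close>

lemma square_norm_diff:
  fixes u v :: "'a \<Rightarrow> 'b :: {banach, second_countable_topology}"
  assumes u: "u \<in> borel_measurable M" "integrable M (\<lambda>x. (norm (u x))\<^sup>2)"
    and v: "v \<in> borel_measurable M" "integrable M (\<lambda>x. (norm (v x))\<^sup>2)"
  shows "integrable M (\<lambda>x. (norm (u x - v x))\<^sup>2)"
    and "(LINT x|M. (norm (u x - v x))\<^sup>2) \<le> 2 * (LINT x|M. (norm (u x))\<^sup>2) + 2 * (LINT x|M. (norm (v x))\<^sup>2)"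
proof -
  have le: "(norm (u x - v x))\<^sup>2 \<le> 2 * (norm (u x))\<^sup>2 + 2 * (norm (v x))\<^sup>2" for x
  proof -
    have "(norm (u x - v x))\<^sup>2 \<le> (norm (u x) + norm (v x))\<^sup>2"
      by (intro power_mono norm_triangle_ineq4) simp
    also have "\<dots> \<le> 2 * (norm (u x))\<^sup>2 + 2 * (norm (v x))\<^sup>2"
      using zero_le_power2[of "norm (u x) - norm (v x)"] by (simp add: power2_eq_square algebra_simps)
    finally show ?thesis .
  qed
  have i: "integrable M (\<lambda>x. 2 * (norm (u x))\<^sup>2 + 2 * (norm (v x))\<^sup>2)"
    using u(2) v(2) by auto
  then show i': "integrable M (\<lambda>x. (norm (u x - v x))\<^sup>2)"
  proof (rule Bochner_Integration.integrable_bound)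
    show "(\<lambda>x. (norm (u x - v x))\<^sup>2) \<in> borel_measurable M" using u(1) v(1) by measurable
    show "AE x in M. norm ((norm (u x - v x))\<^sup>2) \<le> norm (2 * (norm (u x))\<^sup>2 + 2 * (norm (v x))\<^sup>2)"
      using le by (intro AE_I2) simp
  qed
  have "(LINT x|M. (norm (u x - v x))\<^sup>2) \<le> (LINT x|M. 2 * (norm (u x))\<^sup>2 + 2 * (norm (v x))\<^sup>2)"
    using i' i le by (intro integral_mono)
  also have "\<dots> = 2 * (LINT x|M. (norm (u x))\<^sup>2) + 2 * (LINT x|M. (norm (v x))\<^sup>2)"
    using u(2) v(2) by simp
  finally show "(LINT x|M. (norm (u x - v x))\<^sup>2) \<le> 2 * (LINT x|M. (norm (u x))\<^sup>2) + 2 * (LINT x|M. (norm (v x))\<^sup>2)" .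
qed

text \<open>The variance is nonnegative.\<close>

lemma (in prob_space) square_expectation_le:
  fixes u :: "'a \<Rightarrow> real"
  assumes "u \<in> borel_measurable M" "integrable M (\<lambda>x. (u x)\<^sup>2)"
  shows "(expectation u)\<^sup>2 \<le> expectation (\<lambda>x. (u x)\<^sup>2)"
  using variance_positive[of u] variance_eq[OF square_integrable_imp_integrable[OF assms] assms(2)] by simp

context iid_product
begin

text \<open>The normalized weighted averages of the \<open>h n\<close> are means. The lower bound on the variances keeps the
normalization away from 0, so that the means are asymptotically invariant.\<close>

lemma invariant_mean_of_almost_invariant_cylinders:
  fixes h :: "nat \<Rightarrow> ('i \<Rightarrow> 'x) \<Rightarrow> real"
  assumes coord: "\<And>g. g \<in> D \<Longrightarrow> coordinate_map (act g) (T g)"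
    and h: "\<And>n. h n \<in> bounded_measurable" "\<And>n. depends_only_on (J n) (h n)"
    and J: "\<And>n. J n \<subseteq> I" "\<And>n. finite (J n)"
    and upper: "\<And>n. (LINT x|M. (h n x)\<^sup>2) \<le> b"
    and lower: "0 < \<delta>" "\<And>n. \<delta> \<le> (LINT x|M. (h n x)\<^sup>2) - (LINT x|M. h n x)\<^sup>2"
    and inv: "\<And>g. g \<in> D \<Longrightarrow> (\<lambda>n. LINT x|M. (h n (T g x) - h n x)\<^sup>2) \<longlonglongrightarrow> 0"
  shows "admits_invariant_mean D I act"
proof (rule invariant_mean_of_asymptotically_invariant_means)
  define m where "m n \<phi> = weighted_average (J n) (h n) \<phi> / weighted_average (J n) (h n) (\<lambda>_. 1)" for n \<phi>
  have mass: "\<delta> \<le> weighted_average (J n) (h n) (\<lambda>_. 1)" for n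
    using lower(2)[of n] weighted_average_one[OF h J] by simp
  show "is_mean I (m n)" for n
    unfolding m_def using mass[of n] lower(1) by (intro is_mean_weighted_average h J) linarith
  show "act g i \<in> I" if "g \<in> D" "i \<in> I" for g i
    using coordinate_map_range[OF coord[OF that(1)]] that(2) by blast
  have "0 \<le> (LINT x|M. (h 0 x)\<^sup>2)" by simp
  with upper[of 0] have "0 \<le> b" by linarith
  fix g \<phi> assume g: "g \<in> D" and "\<phi> \<in> bounded_functions I"
  then obtain c where c: "0 < c" "\<forall>i\<in>I. \<bar>\<phi> i\<bar> \<le> c"
    using bounded_functions_bound by blast
  define U where "U n = (LINT x|M. (h n (T g x) - h n x)\<^sup>2)" for n
  \<comment> \<open>the bound of \<open>weighted_average_almost_invariant\<close> is used with \<open>s = 1 / V n\<close>, which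
    balances its two terms; the summand \<open>1 / (n + 1)\<close> keeps \<open>V n\<close> positive\<close>
  define V where "V n = sqrt (U n + 1 / (real n + 1))" for n
  have U0: "0 \<le> U n" for n by (simp add: U_def)
  have V: "0 < V n" "U n \<le> V n * V n" for n
    using U0[of n] by (simp_all add: V_def add_nonneg_pos)
  have "V \<longlonglongrightarrow> sqrt (0 + 0)"
    unfolding V_def using inv[OF g] LIMSEQ_inverse_real_of_nat
    by (intro tendsto_intros) (simp_all add: U_def inverse_eq_divide add.commute)
  then have V0: "V \<longlonglongrightarrow> 0" by simp
  have bound: "\<bar>m n (\<lambda>i. \<phi> (act g i)) - m n \<phi>\<bar> \<le> c * (1 + 4 * b) / (2 * \<delta>) * V n" for n
  proof -
    let ?d = "\<bar>weighted_average (J n) (h n) (\<lambda>i. \<phi> (act g i)) - weighted_average (J n) (h n) \<phi>\<bar>"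
    have "?d \<le> c * (1 / V n * U n + 4 * (LINT x|M. (h n x)\<^sup>2) / (1 / V n)) / 2"
      unfolding U_def using V(1)[of n] c
      by (intro weighted_average_almost_invariant coord[OF g] h J) auto
    also have "\<dots> \<le> c * (V n + 4 * b * V n) / 2"
    proof -
      have "1 / V n * U n \<le> V n" using V[of n] by (simp add: divide_le_eq)
      moreover have "4 * (LINT x|M. (h n x)\<^sup>2) / (1 / V n) \<le> 4 * b * V n"
        using V(1)[of n] upper[of n] by simp
      ultimately show ?thesis using c(1) by (intro divide_right_mono mult_left_mono add_mono) auto
    qed
    finally have d: "?d \<le> c * (1 + 4 * b) * V n / 2" by (simp add: algebra_simps)
    have "\<bar>m n (\<lambda>i. \<phi> (act g i)) - m n \<phi>\<bar> = ?d / weighted_average (J n) (h n) (\<lambda>_. 1)"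
      using mass[of n] lower(1) by (simp add: m_def flip: diff_divide_distrib)
    also have "\<dots> \<le> (c * (1 + 4 * b) * V n / 2) / \<delta>"
      using order_trans[OF abs_ge_zero d] d mass[of n] lower(1) by (intro frac_le) auto
    finally show ?thesis by simp
  qed
  have null: "(\<lambda>n. c * (1 + 4 * b) / (2 * \<delta>) * V n) \<longlonglongrightarrow> 0"
    using tendsto_mult_left[OF V0, of "c * (1 + 4 * b) / (2 * \<delta>)"] unfolding mult_zero_right .
  show "(\<lambda>n. m n (\<lambda>i. \<phi> (act g i)) - m n \<phi>) \<longlonglongrightarrow> 0"
    by (rule Lim_null_comparison[OF eventuallyI null]) (use bound in simp)
qed

text \<open>Replacing the functions by bounded cylinder functions at distance tending to 0 preserves almost
invariance, and squares of norms between \<open>1 / 2\<close> and 1 leave room for the bounds on norm and variance.\<close>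

lemma invariant_mean_of_almost_invariant_functions:
  fixes a :: "nat \<Rightarrow> ('i \<Rightarrow> 'x) \<Rightarrow> real"
  assumes coord: "\<And>g. g \<in> D \<Longrightarrow> coordinate_map (act g) (T g)"
    and a: "\<And>n. a n \<in> borel_measurable M" "\<And>n. integrable M (\<lambda>x. (a n x)\<^sup>2)"
    and mean_zero: "\<And>n. (LINT x|M. a n x) = 0"
    and norm: "\<And>n. 1 / 2 \<le> (LINT x|M. (a n x)\<^sup>2)" "\<And>n. (LINT x|M. (a n x)\<^sup>2) \<le> 1"
    and inv: "\<And>g. g \<in> D \<Longrightarrow> (\<lambda>n. LINT x|M. (a n (T g x) - a n x)\<^sup>2) \<longlonglongrightarrow> 0"
  shows "admits_invariant_mean D I act"
proof -
  \<comment> \<open>\<open>1 / 16\<close> is small enough for the variances to be at least \<open>1 / 8\<close>\<close>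
  define e where "e n = 1 / (16 * (real n + 1))" for n
  have e: "0 < e n" "e n \<le> 1 / 16" for n by (auto simp: e_def field_simps)
  have "\<forall>n. \<exists>J h. finite J \<and> J \<subseteq> I \<and> h \<in> bounded_measurable \<and> depends_only_on J h \<and>
    integrable M (\<lambda>x. (a n x - h x)\<^sup>2) \<and> (LINT x|M. (a n x - h x)\<^sup>2) < e n"
    by (intro allI cylinder_approx_L2 a e)
  from choice[OF this] obtain J where "\<forall>n. \<exists>h. finite (J n) \<and> J n \<subseteq> I \<and>
    h \<in> bounded_measurable \<and> depends_only_on (J n) h \<and>
    integrable M (\<lambda>x. (a n x - h x)\<^sup>2) \<and> (LINT x|M. (a n x - h x)\<^sup>2) < e n" ..
  from choice[OF this] obtain h where "\<forall>n. finite (J n) \<and> J n \<subseteq> I \<and>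
    h n \<in> bounded_measurable \<and> depends_only_on (J n) (h n) \<and>
    integrable M (\<lambda>x. (a n x - h n x)\<^sup>2) \<and> (LINT x|M. (a n x - h n x)\<^sup>2) < e n" ..
  then have J: "\<And>n. finite (J n)" "\<And>n. J n \<subseteq> I"
    and h: "\<And>n. h n \<in> bounded_measurable" "\<And>n. depends_only_on (J n) (h n)"
    and ah: "\<And>n. integrable M (\<lambda>x. (a n x - h n x)\<^sup>2)" "\<And>n. (LINT x|M. (a n x - h n x)\<^sup>2) < e n"
    by simp_all
  have hm: "h n \<in> borel_measurable M" for n using h(1) by (rule bounded_measurable_borel)
  have hi: "integrable M (\<lambda>x. (h n x)\<^sup>2)" for n
    using bounded_measurable_integrable[OF bounded_measurable_mult[OF h(1) h(1)]]
    by (simp add: power2_eq_square)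
  note diff = square_norm_diff[where 'b = real, unfolded real_norm_def power2_abs]
  have dm: "(\<lambda>x. a n x - h n x) \<in> borel_measurable M" for n using a(1) hm by measurable
  have upper: "(LINT x|M. (h n x)\<^sup>2) \<le> 3" for n
    using diff(2)[OF a dm ah(1), of n n] norm(2)[of n] ah(2)[of n] e(2)[of n] by simp
  have lower: "1 / 8 \<le> (LINT x|M. (h n x)\<^sup>2) - (LINT x|M. h n x)\<^sup>2" for n
  proof -
    have "(LINT x|M. (a n x)\<^sup>2) \<le> 2 * (LINT x|M. (a n x - h n x)\<^sup>2) + 2 * (LINT x|M. (- h n x)\<^sup>2)"
      using diff(2)[OF dm[of n] ah(1)[of n], of "\<lambda>x. - h n x"] hm[of n] hi[of n] by simp
    then have "1 / 8 + e n \<le> (LINT x|M. (h n x)\<^sup>2)"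
      using norm(1)[of n] ah(2)[of n] e(2)[of n] by simp
    moreover have "(LINT x|M. h n x)\<^sup>2 \<le> e n"
    proof -
      have "(LINT x|M. a n x - h n x) = - (LINT x|M. h n x)"
        using P.square_integrable_imp_integrable[OF a(1,2)] bounded_measurable_integrable[OF h(1)]
        by (simp add: mean_zero)
      then show ?thesis
        using P.square_expectation_le[OF dm ah(1), of n] ah(2)[of n] by simp
    qed
    ultimately show ?thesis by simp
  qed
  show ?thesis
  proof (rule invariant_mean_of_almost_invariant_cylinders[OF coord h J(2,1) upper _ lower])
    fix g assume g: "g \<in> D"
    note T = coordinate_map_measurable[OF coord[OF g]]
    note int = coordinate_map_integral[OF coord[OF g]]
    have comp: "integrable M (\<lambda>x. f (T g x))" if "integrable M f" for f :: "_ \<Rightarrow> real"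
      using integrable_distr[OF T, of f] that by (simp add: coordinate_map_distr[OF coord[OF g]])
    have bound: "(LINT x|M. (h n (T g x) - h n x)\<^sup>2) \<le> 6 * e n + 4 * (LINT x|M. (a n (T g x) - a n x)\<^sup>2)" for n
    proof -
      let ?d = "\<lambda>x. a n x - h n x" let ?A = "\<lambda>x. a n (T g x) - a n x"
      have dT: "(\<lambda>x. ?d (T g x)) \<in> borel_measurable M" using T dm by (rule measurable_compose)
      have aT: "(\<lambda>x. a n (T g x)) \<in> borel_measurable M" using T a(1) by (rule measurable_compose)
      have A: "?A \<in> borel_measurable M" using aT a(1) by measurable
      have iA: "integrable M (\<lambda>x. (?A x)\<^sup>2)"
        using aT comp[OF a(2)] a by (rule diff(1))
      have iT: "integrable M (\<lambda>x. (?d (T g x))\<^sup>2)" using ah(1) by (rule comp)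
      have B: "(\<lambda>x. ?A x - ?d (T g x)) \<in> borel_measurable M" using A dT by measurable
      have iB: "integrable M (\<lambda>x. (?A x - ?d (T g x))\<^sup>2)"
        using A iA dT iT by (rule diff(1))
      have neg: "(h n x - a n x)\<^sup>2 = (?d x)\<^sup>2" for x by (rule power2_commute)
      have "(LINT x|M. (?A x - ?d (T g x) - (h n x - a n x))\<^sup>2)
          \<le> 2 * (LINT x|M. (?A x - ?d (T g x))\<^sup>2) + 2 * (LINT x|M. (h n x - a n x)\<^sup>2)"
        using B iB by (rule diff(2)) (use a(1) hm in measurable, use ah(1) in \<open>simp add: neg\<close>)
      also have "(LINT x|M. (?A x - ?d (T g x))\<^sup>2)
          \<le> 2 * (LINT x|M. (?A x)\<^sup>2) + 2 * (LINT x|M. (?d (T g x))\<^sup>2)"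
        using A iA dT iT by (rule diff(2))
      also have "(LINT x|M. (?d (T g x))\<^sup>2) = (LINT x|M. (?d x)\<^sup>2)"
        using int[of "\<lambda>x. (?d x)\<^sup>2"] dm by simp
      also have "(LINT x|M. (?A x - ?d (T g x) - (h n x - a n x))\<^sup>2) = (LINT x|M. (h n (T g x) - h n x)\<^sup>2)"
        by simp
      finally show ?thesis using ah(2)[of n] by (simp add: neg)
    qed
    have "e \<longlonglongrightarrow> 0"
      using tendsto_mult_left[OF LIMSEQ_inverse_real_of_nat, of "1 / 16"]
      by (simp add: e_def[abs_def] inverse_eq_divide add.commute)
    then have "(\<lambda>n. 6 * e n + 4 * (LINT x|M. (a n (T g x) - a n x)\<^sup>2)) \<longlonglongrightarrow> 6 * 0 + 4 * 0"
      by (intro tendsto_intros inv[OF g])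
    then have null: "(\<lambda>n. 6 * e n + 4 * (LINT x|M. (a n (T g x) - a n x)\<^sup>2)) \<longlonglongrightarrow> 0"
      by simp
    show "(\<lambda>n. LINT x|M. (h n (T g x) - h n x)\<^sup>2) \<longlonglongrightarrow> 0"
      by (rule Lim_null_comparison[OF eventuallyI null]) (use bound in simp)
  qed simp_all
qed

end

section \<open>The coinduced action\<close>

context iid_product
begin

text \<open>The preimage of a box over \<open>J\<close> is a box over \<open>p ` J\<close> whose sides have the same measures.\<close>

lemma coordinate_mapI:
  assumes p: "inj_on p I" "p ` I \<subseteq> I"
    and s: "\<And>j. j \<in> I \<Longrightarrow> s j \<in> N \<rightarrow>\<^sub>M N" "\<And>j. j \<in> I \<Longrightarrow> distr N N (s j) = N"
    and \<tau>: "\<And>x. x \<in> space M \<Longrightarrow> \<tau> x = (\<lambda>j\<in>I. s j (x (p j)))"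
  shows "coordinate_map p \<tau>"
proof -
  have "(\<lambda>x. \<lambda>j\<in>I. s j (x (p j))) \<in> M \<rightarrow>\<^sub>M M"
  proof (rule measurable_restrict)
    fix j assume j: "j \<in> I"
    then have "p j \<in> I" using p by blast
    then have "(\<lambda>x. x (p j)) \<in> M \<rightarrow>\<^sub>M N" by (rule measurable_component_singleton)
    then show "(\<lambda>x. s j (x (p j))) \<in> M \<rightarrow>\<^sub>M N" using s(1)[OF j] by (rule measurable_compose)
  qed
  then have meas: "\<tau> \<in> M \<rightarrow>\<^sub>M M"
    using measurable_cong[of M \<tau> "\<lambda>x. \<lambda>j\<in>I. s j (x (p j))" M] \<tau> by blast
  have "distr M M \<tau> = M"
  proof (rule PiM_eq)
    fix J F assume J: "finite J" "J \<subseteq> I" and F: "\<And>j. j \<in> J \<Longrightarrow> F j \<in> sets N"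
    define q where "q = the_inv_into J p"
    have inj: "inj_on p J" using p(1) J(2) by (rule inj_on_subset)
    have q: "q (p j) = j" if "j \<in> J" for j
      unfolding q_def using inj that by (rule the_inv_into_f_f)
    define E where "E i = s (q i) -` F (q i) \<inter> space N" for i
    have Ep: "E (p j) = s j -` F j \<inter> space N" if "j \<in> J" for j
      using q[OF that] by (simp add: E_def)
    have E: "E i \<in> sets N" if "i \<in> p ` J" for i
      using that J F s(1) Ep by (auto intro!: measurable_sets)
    have "emeasure (distr M M \<tau>) (prod_emb I (\<lambda>_. N) J (\<Pi>\<^sub>E j\<in>J. F j))
        = emeasure M (\<tau> -` prod_emb I (\<lambda>_. N) J (\<Pi>\<^sub>E j\<in>J. F j) \<inter> space M)"
      using J F by (intro emeasure_distr meas sets_PiM_I) auto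
    also have "\<tau> -` prod_emb I (\<lambda>_. N) J (\<Pi>\<^sub>E j\<in>J. F j) \<inter> space M
        = prod_emb I (\<lambda>_. N) (p ` J) (\<Pi>\<^sub>E i\<in>p ` J. E i)"
    proof -
      have box: "x \<in> prod_emb I (\<lambda>_. N) K (\<Pi>\<^sub>E i\<in>K. B i) \<longleftrightarrow> x \<in> space M \<and> (\<forall>i\<in>K. x i \<in> B i)"
        if "K \<subseteq> I" for x K and B :: "'i \<Rightarrow> 'x set"
        using that by (auto simp: prod_emb_def space_M PiE_iff extensional_def)
      have pJ: "p ` J \<subseteq> I" using p(2) J(2) by blast
      have "\<tau> x \<in> prod_emb I (\<lambda>_. N) J (\<Pi>\<^sub>E j\<in>J. F j) \<longleftrightarrow> (\<forall>i\<in>p ` J. x i \<in> E i)"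
        if x: "x \<in> space M" for x
      proof -
        have "\<tau> x j \<in> F j \<longleftrightarrow> x (p j) \<in> E (p j)" if "j \<in> J" for j
        proof -
          have "j \<in> I" "p j \<in> I" using that J(2) pJ by blast+
          then show ?thesis using x that by (simp add: \<tau> Ep space_M)
        qed
        then show ?thesis
          using measurable_space[OF meas x] by (auto simp: box[OF J(2)])
      qed
      then show ?thesis by (auto simp: box[OF pJ])
    qed
    also have "emeasure M \<dots> = (\<Prod>i\<in>p ` J. emeasure N (E i))"
      using J p E by (intro emeasure_PiM_emb) auto
    also have "\<dots> = (\<Prod>j\<in>J. emeasure N (F j))"
    proof -
      have "emeasure N (E (p j)) = emeasure N (F j)" if "j \<in> J" for j
      proof -
        have "emeasure (distr N N (s j)) (F j) = emeasure N (E (p j))"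
          using that J F s(1) Ep by (subst emeasure_distr) auto
        then show ?thesis using s(2) that J by auto
      qed
      then show ?thesis by (simp add: prod.reindex[OF inj])
    qed
    finally show "emeasure (distr M M \<tau>) (prod_emb I (\<lambda>_. N) J (\<Pi>\<^sub>E j\<in>J. F j))
        = (\<Prod>j\<in>J. emeasure N (F j))" .
  qed simp
  moreover have "\<tau> x j = \<tau> y j"
    if "x \<in> space M" "y \<in> space M" "j \<in> I" "x (p j) = y (p j)" for x y j
    using that \<tau> by simp
  ultimately show ?thesis
    unfolding coordinate_map_def using meas p by blast
qed

end

lemma (in group) lcoset_translate_closed:
  assumes "subgroup S G" "g \<in> carrier G" "i \<in> lcosets S"
  shows "g <# i \<in> lcosets S"
  using assms subgroup.subset[OF assms(1)] by (auto simp: LCOSETS_def lcos_m_assoc)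

lemma (in group) lcoset_translate_assoc:
  assumes "subgroup S G" "g \<in> carrier G" "h \<in> carrier G" "i \<in> lcosets S"
  shows "g <# (h <# i) = (g \<otimes> h) <# i"
  using subgroup.lcosets_carrier[OF assms(1) is_group assms(4)] assms by (simp add: lcos_m_assoc)

lemma (in group) lcoset_translate_one:
  assumes "subgroup S G" "i \<in> lcosets S"
  shows "\<one> <# i = i"
  using subgroup.lcosets_carrier[OF assms(1) is_group assms(2)] by (simp add: lcos_mult_one)

lemma (in group) lcoset_translate_inv:
  assumes "subgroup S G" "g \<in> carrier G" "i \<in> lcosets S"
  shows "inv g <# (g <# i) = i" "g <# (inv g <# i) = i"
  using assms by (simp_all add: lcoset_translate_assoc[OF assms(1)] lcoset_translate_one[OF assms(1)])

text \<open>Both \<open>\<phi> (g i)\<close> and \<open>g \<otimes> \<phi> i\<close> represent the coset \<open>g i\<close>.\<close>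

lemma (in group) section_cocycle_mem:
  assumes S: "subgroup S G" and \<phi>: "quotient_section G S \<phi>" and g: "g \<in> carrier G" and i: "i \<in> lcosets S"
  shows "section_cocycle G \<phi> g i \<in> S"
proof -
  have gi: "g <# i \<in> lcosets S" using S g i by (rule lcoset_translate_closed)
  have \<phi>i: "\<phi> i \<in> carrier G" "\<phi> i <# S = i" and \<phi>gi: "\<phi> (g <# i) \<in> carrier G" "\<phi> (g <# i) <# S = g <# i"
    using \<phi> i gi unfolding quotient_section_def by blast+
  have "g \<otimes> \<phi> i \<in> (g \<otimes> \<phi> i) <# S"
    using S g \<phi>i(1) by (intro lcos_self) auto
  also have "(g \<otimes> \<phi> i) <# S = \<phi> (g <# i) <# S"
    using lcos_m_assoc[OF subgroup.subset[OF S] g \<phi>i(1)] \<phi>i(2) \<phi>gi(2) by simp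
  finally have "inv \<phi> (g <# i) \<otimes> (g \<otimes> \<phi> i) \<in> S"
    using \<phi>gi(1) by (intro subgroup.lcos_module_imp[OF S is_group])
  then show ?thesis
    using \<phi>i(1) \<phi>gi(1) g by (simp add: section_cocycle_def m_assoc)
qed

text \<open>The cocycle identity; it makes the coinduced formula multiplicative in the group element.\<close>

lemma (in group) section_cocycle_mult:
  assumes S: "subgroup S G" and \<phi>: "quotient_section G S \<phi>"
    and g: "g \<in> carrier G" and h: "h \<in> carrier G" and i: "i \<in> lcosets S"
  shows "section_cocycle G \<phi> (g \<otimes> h) i = section_cocycle G \<phi> g (h <# i) \<otimes> section_cocycle G \<phi> h i"
proof -
  have hi: "h <# i \<in> lcosets S" using S h i by (rule lcoset_translate_closed)
  then have ghi: "g <# (h <# i) \<in> lcosets S" using S g by (intro lcoset_translate_closed[OF S g])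
  have c: "\<phi> i \<in> carrier G" "\<phi> (h <# i) \<in> carrier G" "\<phi> (g <# (h <# i)) \<in> carrier G"
    using \<phi> i hi ghi unfolding quotient_section_def by blast+
  have "\<phi> (h <# i) \<otimes> (inv \<phi> (h <# i) \<otimes> (h \<otimes> \<phi> i)) = h \<otimes> \<phi> i"
    using c h by (simp flip: m_assoc)
  then show ?thesis
    using c g h by (simp add: section_cocycle_def m_assoc flip: lcoset_translate_assoc[OF S g h i])
qed

lemma (in group) section_cocycle_one:
  assumes S: "subgroup S G" and \<phi>: "quotient_section G S \<phi>" and i: "i \<in> lcosets S"
  shows "section_cocycle G \<phi> \<one> i = \<one>"
  using \<phi> i unfolding quotient_section_def
  by (simp add: section_cocycle_def lcoset_translate_one[OF S i])

lemma pmp_actionD: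
  assumes "pmp_action G M \<sigma>"
  shows "group_action G (space M) \<sigma>" "g \<in> carrier G \<Longrightarrow> \<sigma> g \<in> M \<rightarrow>\<^sub>M M"
    "g \<in> carrier G \<Longrightarrow> distr M M (\<sigma> g) = M"
  using assms unfolding pmp_action_def by auto

lemma pmp_actionI:
  assumes "group G"
    and ext: "\<And>g. g \<in> carrier G \<Longrightarrow> \<sigma> g \<in> extensional (space M)"
    and meas: "\<And>g. g \<in> carrier G \<Longrightarrow> \<sigma> g \<in> M \<rightarrow>\<^sub>M M"
    and distr: "\<And>g. g \<in> carrier G \<Longrightarrow> distr M M (\<sigma> g) = M"
    and mult: "\<And>g h x. g \<in> carrier G \<Longrightarrow> h \<in> carrier G \<Longrightarrow> x \<in> space M \<Longrightarrow> \<sigma> (g \<otimes>\<^bsub>G\<^esub> h) x = \<sigma> g (\<sigma> h x)"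
    and one: "\<And>x. x \<in> space M \<Longrightarrow> \<sigma> \<one>\<^bsub>G\<^esub> x = x"
  shows "pmp_action G M \<sigma>"
proof -
  interpret group G by fact
  have sp: "\<sigma> g x \<in> space M" if "g \<in> carrier G" "x \<in> space M" for g x
    using measurable_space[OF meas] that by blast
  have Bij: "\<sigma> g \<in> Bij (space M)" if g: "g \<in> carrier G" for g
  proof -
    have "bij_betw (\<sigma> g) (space M) (space M)"
    proof (rule bij_betw_byWitness[where f' = "\<sigma> (inv\<^bsub>G\<^esub> g)"])
      show "\<forall>x\<in>space M. \<sigma> (inv\<^bsub>G\<^esub> g) (\<sigma> g x) = x"
        using g by (simp add: mult[symmetric] one)
      show "\<forall>x\<in>space M. \<sigma> g (\<sigma> (inv\<^bsub>G\<^esub> g) x) = x"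
        using g by (simp add: mult[symmetric] one)
    qed (use g sp in auto)
    then show ?thesis using ext[OF g] by (simp add: Bij_def)
  qed
  have "\<sigma> (g \<otimes>\<^bsub>G\<^esub> h) = compose (space M) (\<sigma> g) (\<sigma> h)"
    if "g \<in> carrier G" "h \<in> carrier G" for g h
    by (rule extensionalityI[of _ "space M"]) (use that ext mult in \<open>auto simp: compose_def\<close>)
  then have "\<sigma> \<in> hom G (BijGroup (space M))"
    using Bij by (auto simp: hom_def BijGroup_def)
  then have "group_action G (space M) \<sigma>"
    by (simp add: group_action_def group_hom_def group_hom_axioms_def is_group group_BijGroup)
  then show ?thesis
    using meas distr by (simp add: pmp_action_def)
qed

lemma pmp_action_mult:
  assumes "pmp_action G M \<sigma>" "g \<in> carrier G" "h \<in> carrier G" "x \<in> space M"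
  shows "\<sigma> (g \<otimes>\<^bsub>G\<^esub> h) x = \<sigma> g (\<sigma> h x)"
  using group_action.composition_rule[OF pmp_actionD(1)[OF assms(1)]] assms(2-4) by blast

lemma pmp_action_one:
  assumes "pmp_action G M \<sigma>" "x \<in> space M"
  shows "\<sigma> \<one>\<^bsub>G\<^esub> x = x"
  using group_action.id_eq_one[OF pmp_actionD(1)[OF assms(1)]] assms(2) by (metis restrict_apply')

lemma pmp_action_subgroup:
  assumes "group G" "pmp_action G M \<sigma>" "subgroup D G"
  shows "pmp_action (G\<lparr>carrier := D\<rparr>) M \<sigma>"
proof -
  have D: "g \<in> D \<Longrightarrow> g \<in> carrier G" for g using subgroup.subset[OF assms(3)] by blast
  show ?thesis
  proof (rule pmp_actionI)
    show "group (G\<lparr>carrier := D\<rparr>)"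
      using assms(3,1) by (rule subgroup.subgroup_is_group)
    show "\<sigma> g \<in> extensional (space M)" if "g \<in> carrier (G\<lparr>carrier := D\<rparr>)" for g
      using group_action.bij_prop0[OF pmp_actionD(1)[OF assms(2)]] D that by (auto simp: Bij_def)
  qed (use D pmp_actionD(2,3)[OF assms(2)] pmp_action_mult[OF assms(2)] pmp_action_one[OF assms(2)] in auto)
qed

locale coinduction = group \<Gamma> + iid_product N "lcosets\<^bsub>\<Gamma>\<^esub> \<Sigma>"
  for \<Gamma> :: "('g, 'm) monoid_scheme" (structure) and \<Sigma> :: "'g set" and N :: "'x measure" +
  fixes \<sigma>0 :: "'g \<Rightarrow> 'x \<Rightarrow> 'x" and \<phi> :: "'g set \<Rightarrow> 'g"
  assumes subgroup: "subgroup \<Sigma> \<Gamma>"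
    and base_action: "pmp_action (\<Gamma>\<lparr>carrier := \<Sigma>\<rparr>) N \<sigma>0"
    and section_map: "quotient_section \<Gamma> \<Sigma> \<phi>"
begin

abbreviation \<sigma> :: "'g \<Rightarrow> ('g set \<Rightarrow> 'x) \<Rightarrow> ('g set \<Rightarrow> 'x)" where
  "\<sigma> \<equiv> coinduced_action \<Gamma> \<Sigma> N \<phi> \<sigma>0"

lemma coinduced_space_eq: "coinduced_space \<Gamma> \<Sigma> N = M"
  by (simp add: coinduced_space_def)

lemma coinduced_action_eq:
  assumes "x \<in> space M" "g \<in> carrier \<Gamma>"
  shows "\<sigma> g x = (\<lambda>j\<in>lcosets \<Sigma>. \<sigma>0 (section_cocycle \<Gamma> \<phi> g (inv g <# j)) (x (inv g <# j)))"
  using assms by (simp add: coinduced_action_def coinduced_space_eq Let_def)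

lemma coordinate_map_coinduced:
  assumes g: "g \<in> carrier \<Gamma>"
  shows "coordinate_map (\<lambda>j. inv g <# j) (\<sigma> g)"
proof (rule coordinate_mapI)
  have ig: "inv g \<in> carrier \<Gamma>" using g by simp
  show "inj_on (\<lambda>j. inv g <# j) (lcosets \<Sigma>)"
    using lcoset_translate_inv(2)[OF subgroup g] by (rule inj_on_inverseI)
  show "(\<lambda>j. inv g <# j) ` (lcosets \<Sigma>) \<subseteq> lcosets \<Sigma>"
    using lcoset_translate_closed[OF subgroup ig] by blast
  fix j assume j: "j \<in> lcosets \<Sigma>"
  have "section_cocycle \<Gamma> \<phi> g (inv g <# j) \<in> \<Sigma>"
    using subgroup section_map g lcoset_translate_closed[OF subgroup ig j] by (rule section_cocycle_mem)
  then show "\<sigma>0 (section_cocycle \<Gamma> \<phi> g (inv g <# j)) \<in> N \<rightarrow>\<^sub>M N"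
    "distr N N (\<sigma>0 (section_cocycle \<Gamma> \<phi> g (inv g <# j))) = N"
    using pmp_actionD(2,3)[OF base_action] by simp_all
next
  fix x assume "x \<in> space M"
  then show "\<sigma> g x = (\<lambda>j\<in>lcosets \<Sigma>. \<sigma>0 (section_cocycle \<Gamma> \<phi> g (inv g <# j)) (x (inv g <# j)))"
    using g by (rule coinduced_action_eq)
qed

lemma coinduced_action_one:
  assumes "x \<in> space M"
  shows "\<sigma> \<one> x = x"
proof
  fix j
  show "\<sigma> \<one> x j = x j"
  proof (cases "j \<in> lcosets \<Sigma>")
    case True
    then have "x j \<in> space N" using assms by (simp add: space_M)
    then have "\<sigma>0 \<one> (x j) = x j"
      using pmp_action_one[OF base_action] by simp
    then show ?thesis
      using True by (simp add: coinduced_action_eq[OF assms] lcoset_translate_one[OF subgroup]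
          section_cocycle_one[OF subgroup section_map])
  next
    case False
    then show ?thesis
      using assms by (auto simp: coinduced_action_eq[OF assms] space_M extensional_def)
  qed
qed

lemma coinduced_action_mult:
  assumes g: "g \<in> carrier \<Gamma>" and h: "h \<in> carrier \<Gamma>" and x: "x \<in> space M"
  shows "\<sigma> (g \<otimes> h) x = \<sigma> g (\<sigma> h x)"
proof
  fix j
  have hx: "\<sigma> h x \<in> space M"
    using coordinate_map_in_space[OF coordinate_map_coinduced[OF h] x] .
  show "\<sigma> (g \<otimes> h) x j = \<sigma> g (\<sigma> h x) j"
  proof (cases "j \<in> lcosets \<Sigma>")
    case j: True
    let ?k = "inv g <# j" let ?i = "inv h <# ?k"
    have k: "?k \<in> lcosets \<Sigma>" using subgroup g j by (intro lcoset_translate_closed) auto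
    have i: "?i \<in> lcosets \<Sigma>" using h by (intro lcoset_translate_closed[OF subgroup _ k]) simp
    have gh: "inv (g \<otimes> h) <# j = ?i"
      using g h j by (simp add: inv_mult_group lcoset_translate_assoc[OF subgroup])
    have hi: "h <# ?i = ?k" using lcoset_translate_inv(2)[OF subgroup h k] .
    have mem: "section_cocycle \<Gamma> \<phi> g ?k \<in> \<Sigma>" "section_cocycle \<Gamma> \<phi> h ?i \<in> \<Sigma>"
      using section_cocycle_mem[OF subgroup section_map] g h k i by blast+
    have "\<sigma> (g \<otimes> h) x j = \<sigma>0 (section_cocycle \<Gamma> \<phi> (g \<otimes> h) ?i) (x ?i)"
      using g h j by (simp add: coinduced_action_eq[OF x] gh)
    also have "\<dots> = \<sigma>0 (section_cocycle \<Gamma> \<phi> g ?k \<otimes> section_cocycle \<Gamma> \<phi> h ?i) (x ?i)"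
      using section_cocycle_mult[OF subgroup section_map g h i] by (simp add: hi)
    also have "\<dots> = \<sigma>0 (section_cocycle \<Gamma> \<phi> g ?k) (\<sigma>0 (section_cocycle \<Gamma> \<phi> h ?i) (x ?i))"
      using pmp_action_mult[OF base_action] mem x i by (simp add: space_M)
    also have "\<sigma>0 (section_cocycle \<Gamma> \<phi> h ?i) (x ?i) = \<sigma> h x ?k"
      using k by (simp add: coinduced_action_eq[OF x h])
    also have "\<sigma>0 (section_cocycle \<Gamma> \<phi> g ?k) (\<sigma> h x ?k) = \<sigma> g (\<sigma> h x) j"
      using j by (simp add: coinduced_action_eq[OF hx g])
    finally show ?thesis .
  next
    case False
    then show ?thesis
      using g h by (simp add: coinduced_action_eq[OF x m_closed[OF g h]] coinduced_action_eq[OF hx g])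
  qed
qed

lemma pmp_action_coinduced: "pmp_action \<Gamma> M \<sigma>"
proof (rule pmp_actionI)
  show "\<sigma> g \<in> extensional (space M)" for g
    by (simp add: coinduced_action_def coinduced_space_eq)
  show "\<sigma> g \<in> M \<rightarrow>\<^sub>M M" "distr M M (\<sigma> g) = M" if "g \<in> carrier \<Gamma>" for g
    using coordinate_map_measurable[OF coordinate_map_coinduced[OF that]]
      coordinate_map_distr[OF coordinate_map_coinduced[OF that]] by simp_all
qed (simp_all add: is_group coinduced_action_mult coinduced_action_one)

end

section \<open>Spectral gap\<close>

lemma L2D:
  assumes "f \<in> L2 M"
  shows "f \<in> borel_measurable M" "integrable M (\<lambda>x. (cmod (f x))\<^sup>2)"
  using assms by (simp_all add: L2_def)

lemma L2_norm_square: "(L2_norm M f)\<^sup>2 = (LINT x|M. (cmod (f x))\<^sup>2)"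
  by (simp add: L2_norm_def)

text \<open>The squares of the real and imaginary parts integrate to 1 in total, so one of them carries at
least half. Passing to that part cannot increase the displacement under an isometry induced by a
transformation, so that almost invariance is preserved.\<close>

lemma (in prob_space) real_part_of_unit_vector:
  assumes \<xi>: "\<xi> \<in> L2_minus_constants M" "L2_norm M \<xi> = 1"
  obtains a :: "complex \<Rightarrow> real" where "a = Re \<or> a = Im"
    "(\<lambda>x. a (\<xi> x)) \<in> borel_measurable M" "integrable M (\<lambda>x. (a (\<xi> x))\<^sup>2)"
    "expectation (\<lambda>x. a (\<xi> x)) = 0"
    "1 / 2 \<le> expectation (\<lambda>x. (a (\<xi> x))\<^sup>2)" "expectation (\<lambda>x. (a (\<xi> x))\<^sup>2) \<le> 1"
proof -
  have L2: "\<xi> \<in> L2 M" and orth: "L2_inner M \<xi> (\<lambda>_. 1) = 0"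
    using \<xi>(1) by (simp_all add: L2_minus_constants_def)
  note meas = L2D(1)[OF L2] and sq = L2D(2)[OF L2]
  have int: "integrable M \<xi>"
  proof -
    have "integrable M (\<lambda>x. cmod (\<xi> x))"
      by (rule square_integrable_imp_integrable) (use meas sq in simp_all)
    then show ?thesis using meas by (simp add: integrable_norm_iff)
  qed
  have zero: "(LINT x|M. \<xi> x) = 0"
    using orth by (simp add: L2_inner_def)
  have part: "(\<lambda>x. a (\<xi> x)) \<in> borel_measurable M \<and> integrable M (\<lambda>x. (a (\<xi> x))\<^sup>2)
    \<and> expectation (\<lambda>x. a (\<xi> x)) = 0 \<and> expectation (\<lambda>x. (a (\<xi> x))\<^sup>2) \<le> 1"
    if a: "a = Re \<or> a = Im" for a
  proof -
    have am: "(\<lambda>x. a (\<xi> x)) \<in> borel_measurable M" using a meas by auto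
    have le: "(a z)\<^sup>2 \<le> (cmod z)\<^sup>2" for z using a by (auto simp: cmod_power2)
    have ai: "integrable M (\<lambda>x. (a (\<xi> x))\<^sup>2)"
      using sq by (rule Bochner_Integration.integrable_bound) (use am le in \<open>auto intro!: AE_I2\<close>)
    have "expectation (\<lambda>x. a (\<xi> x)) = 0"
      using a integral_Re[OF int] integral_Im[OF int] zero by auto
    moreover have "expectation (\<lambda>x. (a (\<xi> x))\<^sup>2) \<le> expectation (\<lambda>x. (cmod (\<xi> x))\<^sup>2)"
      using ai sq le by (intro integral_mono)
    moreover have "expectation (\<lambda>x. (cmod (\<xi> x))\<^sup>2) = 1"
      using L2_norm_square[of M \<xi>] \<xi>(2) by simp
    ultimately show ?thesis using am ai by simp
  qed
  have "1 = expectation (\<lambda>x. (cmod (\<xi> x))\<^sup>2)"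
    using L2_norm_square[of M \<xi>] \<xi>(2) by simp
  also have "\<dots> = expectation (\<lambda>x. (Re (\<xi> x))\<^sup>2) + expectation (\<lambda>x. (Im (\<xi> x))\<^sup>2)"
    using part[of Re] part[of Im] by (simp add: cmod_power2)
  finally have "1 / 2 \<le> expectation (\<lambda>x. (Re (\<xi> x))\<^sup>2) \<or> 1 / 2 \<le> expectation (\<lambda>x. (Im (\<xi> x))\<^sup>2)"
    by linarith
  then show thesis
    using that[of Re] that[of Im] part[of Re] part[of Im] by blast
qed

context coinduction
begin

text \<open>The operator of \<open>g\<close> is composition with \<open>\<sigma> (inv g)\<close>, which reads the coordinate \<open>j\<close> of its output
from \<open>g j\<close>; so the weights are moved by translation with \<open>g\<close> itself.\<close>

lemma invariant_mean_if_no_spectral_gap: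
  assumes \<Delta>: "subgroup \<Delta> \<Gamma>" and no_gap: "\<not> spectral_gap (\<Gamma>\<lparr>carrier := \<Delta>\<rparr>) M \<sigma>"
  shows "amenable_relative_to \<Gamma> \<Delta> \<Sigma>"
proof -
  obtain \<xi> where \<xi>: "\<And>n. \<xi> n \<in> L2_minus_constants M" "\<And>n. L2_norm M (\<xi> n) = 1"
    and inv: "\<And>g. g \<in> \<Delta> \<Longrightarrow>
      (\<lambda>n. L2_norm M (\<lambda>x. koopman (\<Gamma>\<lparr>carrier := \<Delta>\<rparr>) \<sigma> g (\<xi> n) x - \<xi> n x)) \<longlonglongrightarrow> 0"
    using no_gap unfolding spectral_gap_def by auto
  have "\<forall>n. \<exists>a. (a = Re \<or> a = Im) \<and>
    (\<lambda>x. a (\<xi> n x)) \<in> borel_measurable M \<and> integrable M (\<lambda>x. (a (\<xi> n x))\<^sup>2) \<and>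
    P.expectation (\<lambda>x. a (\<xi> n x)) = 0 \<and>
    1 / 2 \<le> P.expectation (\<lambda>x. (a (\<xi> n x))\<^sup>2) \<and> P.expectation (\<lambda>x. (a (\<xi> n x))\<^sup>2) \<le> 1"
    using P.real_part_of_unit_vector[OF \<xi>] by metis
  from choice[OF this] obtain a where a: "\<And>n. a n = Re \<or> a n = Im"
    "\<And>n. (\<lambda>x. a n (\<xi> n x)) \<in> borel_measurable M" "\<And>n. integrable M (\<lambda>x. (a n (\<xi> n x))\<^sup>2)"
    "\<And>n. P.expectation (\<lambda>x. a n (\<xi> n x)) = 0"
    "\<And>n. 1 / 2 \<le> P.expectation (\<lambda>x. (a n (\<xi> n x))\<^sup>2)"
    "\<And>n. P.expectation (\<lambda>x. (a n (\<xi> n x))\<^sup>2) \<le> 1"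
    by auto
  have \<Delta>c: "g \<in> carrier \<Gamma>" if "g \<in> \<Delta>" for g
    using subgroup.subset[OF \<Delta>] that by blast
  have coord: "coordinate_map (\<lambda>j. g <# j) (\<sigma> (inv g))" if "g \<in> \<Delta>" for g
    using coordinate_map_coinduced[of "inv g"] \<Delta>c[OF that] by simp
  have "admits_invariant_mean \<Delta> (lcosets \<Sigma>) (\<lambda>g j. g <# j)"
    using coord a(2-6)
  proof (rule invariant_mean_of_almost_invariant_functions)
    fix g assume g: "g \<in> \<Delta>"
    let ?\<tau> = "\<sigma> (inv g)"
    note meas = coordinate_map_measurable[OF coord[OF g]]
    let ?d = "\<lambda>n x. \<xi> n (?\<tau> x) - \<xi> n x"
    have koop: "koopman (\<Gamma>\<lparr>carrier := \<Delta>\<rparr>) \<sigma> g f = (\<lambda>x. f (?\<tau> x))" for f :: "_ \<Rightarrow> complex"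
      using m_inv_consistent[OF \<Delta> g] by (simp add: koopman_def)
    have bound: "P.expectation (\<lambda>x. (a n (\<xi> n (?\<tau> x)) - a n (\<xi> n x))\<^sup>2) \<le> (L2_norm M (?d n))\<^sup>2" for n
    proof -
      have L2: "\<xi> n \<in> L2 M" using \<xi>(1)[of n] by (simp add: L2_minus_constants_def)
      have \<xi>\<tau>: "(\<lambda>x. \<xi> n (?\<tau> x)) \<in> borel_measurable M"
        using meas L2D(1)[OF L2] by (rule measurable_compose)
      have "integrable M (\<lambda>x. (cmod (\<xi> n (?\<tau> x)))\<^sup>2)"
        using integrable_distr[OF meas, of "\<lambda>x. (cmod (\<xi> n x))\<^sup>2"] L2D(2)[OF L2]
        by (simp add: coordinate_map_distr[OF coord[OF g]])
      with \<xi>\<tau> have i: "integrable M (\<lambda>x. (cmod (?d n x))\<^sup>2)"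
        using L2D[OF L2] by (rule square_norm_diff(1))
      have le: "(a n (\<xi> n (?\<tau> x)) - a n (\<xi> n x))\<^sup>2 \<le> (cmod (?d n x))\<^sup>2" for x
        using a(1)[of n] by (auto simp: cmod_power2)
      have "integrable M (\<lambda>x. (a n (\<xi> n (?\<tau> x)) - a n (\<xi> n x))\<^sup>2)"
        using i
      proof (rule Bochner_Integration.integrable_bound)
        have "(\<lambda>x. a n (\<xi> n (?\<tau> x))) \<in> borel_measurable M"
          using meas a(2) by (rule measurable_compose)
        then show "(\<lambda>x. (a n (\<xi> n (?\<tau> x)) - a n (\<xi> n x))\<^sup>2) \<in> borel_measurable M"
          using a(2)[of n] by measurable
      qed (use le in \<open>auto intro!: AE_I2\<close>)
      then show ?thesis
        unfolding L2_norm_square using i le by (intro integral_mono)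
    qed
    have "(\<lambda>n. (L2_norm M (?d n))\<^sup>2) \<longlonglongrightarrow> 0\<^sup>2"
      using inv[OF g] unfolding koop by (rule tendsto_power)
    then have null: "(\<lambda>n. (L2_norm M (?d n))\<^sup>2) \<longlonglongrightarrow> 0" by simp
    show "(\<lambda>n. P.expectation (\<lambda>x. (a n (\<xi> n (?\<tau> x)) - a n (\<xi> n x))\<^sup>2)) \<longlonglongrightarrow> 0"
      by (rule Lim_null_comparison[OF eventuallyI null]) (use bound in simp)
  qed
  then show ?thesis by (simp add: amenable_relative_to_def)
qed

end

section \<open>Spectral gap implies strong ergodicity\<close>

lemma pmp_action_inv:
  assumes "group G" "pmp_action G M \<sigma>" "g \<in> carrier G" "x \<in> space M"
  shows "\<sigma> (inv\<^bsub>G\<^esub> g) (\<sigma> g x) = x" "\<sigma> g (\<sigma> (inv\<^bsub>G\<^esub> g) x) = x"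
  using pmp_action_mult[OF assms(2), symmetric] pmp_action_one[OF assms(2)] assms(3,4)
    group.inv_closed[OF assms(1)] group.l_inv[OF assms(1)] group.r_inv[OF assms(1)] by simp_all

lemma pmp_action_space:
  assumes "pmp_action G M \<sigma>" "g \<in> carrier G" "x \<in> space M"
  shows "\<sigma> g x \<in> space M"
  using measurable_space[OF pmp_actionD(2)[OF assms(1,2)] assms(3)] .

text \<open>Strong ergodicity speaks of the full group of the orbit relation, while a spectral gap only concerns
the acting group; this inclusion connects the two.\<close>

lemma pmp_action_in_full_group:
  assumes G: "group G" and \<sigma>: "pmp_action G M \<sigma>" and g: "g \<in> carrier G"
  shows "\<sigma> g \<in> full_group M (orbit_equivalence_relation G M \<sigma>)"
proof -
  interpret group G by fact
  let ?h = "inv\<^bsub>G\<^esub> g"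
  have h: "?h \<in> carrier G" using g by simp
  note meas = pmp_actionD(2)[OF \<sigma>] and sp = pmp_action_space[OF \<sigma>] and inv = pmp_action_inv[OF G \<sigma> g]
  have bij: "bij_betw (\<sigma> g) (space M) (space M)"
    by (rule bij_betw_byWitness[where f' = "\<sigma> ?h"]) (use inv sp g h in auto)
  have "the_inv_into (space M) (\<sigma> g) x = \<sigma> ?h x" if "x \<in> space M" for x
    using bij inv(2)[OF that] sp[OF h that] unfolding bij_betw_def by (intro the_inv_into_f_eq) auto
  then have "the_inv_into (space M) (\<sigma> g) \<in> M \<rightarrow>\<^sub>M M"
    using measurable_cong[of M "the_inv_into (space M) (\<sigma> g)" "\<sigma> ?h" M] meas[OF h] by blast
  then have "\<sigma> g \<in> pmp_automorphisms M"
    using bij meas[OF g] pmp_actionD(3)[OF \<sigma> g] by (simp add: pmp_automorphisms_def)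
  moreover have "orbit G \<sigma> (\<sigma> g x) = orbit G \<sigma> x" if x: "x \<in> space M" for x
  proof
    show "orbit G \<sigma> (\<sigma> g x) \<subseteq> orbit G \<sigma> x"
      using g pmp_action_mult[OF \<sigma> _ g x, symmetric] by (auto simp: orbit_def)
    show "orbit G \<sigma> x \<subseteq> orbit G \<sigma> (\<sigma> g x)"
    proof
      fix y assume "y \<in> orbit G \<sigma> x"
      then obtain k where k: "k \<in> carrier G" "y = \<sigma> k x" by (auto simp: orbit_def)
      have "y = \<sigma> (k \<otimes>\<^bsub>G\<^esub> ?h) (\<sigma> g x)"
        using pmp_action_mult[OF \<sigma> k(1) h sp[OF g x]] inv(1)[OF x] k(2) by simp
      then show "y \<in> orbit G \<sigma> (\<sigma> g x)" using k(1) h by (auto simp: orbit_def)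
    qed
  qed
  then have "AE x in M. (\<sigma> g x, x) \<in> orbit_equivalence_relation G M \<sigma>"
    using sp[OF g] by (intro AE_I2) (simp add: orbit_equivalence_relation_def)
  ultimately show ?thesis by (simp add: full_group_def)
qed

definition normalized_indicator :: "'x measure \<Rightarrow> 'x set \<Rightarrow> 'x \<Rightarrow> complex" where
  "normalized_indicator M A x =
    of_real ((indicator A x - measure M A) / sqrt (measure M A * (1 - measure M A)))"

context prob_space
begin

lemma normalized_indicator_L2:
  assumes A: "A \<in> sets M" and pos: "0 < prob A * (1 - prob A)"
  shows "normalized_indicator M A \<in> L2_minus_constants M" "L2_norm M (normalized_indicator M A) = 1"
proof -
  let ?s = "sqrt (prob A * (1 - prob A))"
  have meas: "normalized_indicator M A \<in> borel_measurable M"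
    unfolding normalized_indicator_def[abs_def] using A by measurable
  have sq: "(cmod (normalized_indicator M A x))\<^sup>2
      = (indicator A x * (1 - 2 * prob A) + (prob A)\<^sup>2) / (prob A * (1 - prob A))" for x
  proof -
    have "(cmod (normalized_indicator M A x))\<^sup>2 = (indicator A x - prob A)\<^sup>2 / (prob A * (1 - prob A))"
      using pos unfolding normalized_indicator_def norm_of_real power2_abs power_divide by simp
    also have "(indicator A x - prob A)\<^sup>2 = indicator A x * (1 - 2 * prob A) + (prob A)\<^sup>2"
      by (cases "x \<in> A") (simp_all add: power2_eq_square algebra_simps)
    finally show ?thesis .
  qed
  have ind: "integrable M (indicator A :: 'a \<Rightarrow> real)"
    using A by (intro integrable_real_indicator) (simp_all add: less_top[symmetric])
  then have int: "integrable M (\<lambda>x. indicator A x * (1 - 2 * prob A) + (prob A)\<^sup>2)"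
    by simp
  have L2: "normalized_indicator M A \<in> L2 M"
    unfolding L2_def using meas int by (simp add: sq)
  have "(LINT x|M. (cmod (normalized_indicator M A x))\<^sup>2)
      = (prob A * (1 - 2 * prob A) + (prob A)\<^sup>2) / (prob A * (1 - prob A))"
    unfolding sq using A ind by (simp add: prob_space)
  also have "prob A * (1 - 2 * prob A) + (prob A)\<^sup>2 = prob A * (1 - prob A)"
    by (simp add: power2_eq_square algebra_simps)
  also have "prob A * (1 - prob A) / (prob A * (1 - prob A)) = 1"
    using pos by (intro divide_self less_imp_neq[symmetric])
  finally show "L2_norm M (normalized_indicator M A) = 1"
    by (simp add: L2_norm_def)
  have "L2_inner M (normalized_indicator M A) (\<lambda>_. c) = 0" for c
  proof -
    have "(LINT x|M. (indicator A x - prob A) / ?s) = 0"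
      using A ind by (simp add: prob_space)
    then have "(LINT x|M. normalized_indicator M A x) = 0"
      unfolding normalized_indicator_def integral_complex_of_real by simp
    then show ?thesis by (simp add: L2_inner_def)
  qed
  with L2 show "normalized_indicator M A \<in> L2_minus_constants M"
    by (simp add: L2_minus_constants_def)
qed

text \<open>The operator of \<open>g\<close> turns the indicator of \<open>A\<close> into that of \<open>\<sigma> g ` A\<close>, and the square of the
difference of two indicators is the indicator of the symmetric difference.\<close>

lemma koopman_normalized_indicator:
  assumes G: "group G" and \<sigma>: "pmp_action G M \<sigma>" and g: "g \<in> carrier G"
    and A: "A \<in> sets M" and pos: "0 < prob A * (1 - prob A)"
  shows "(L2_norm M (\<lambda>x. koopman G \<sigma> g (normalized_indicator M A) x - normalized_indicator M A x))\<^sup>2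
    = prob (sym_diff (\<sigma> g ` A) A) / (prob A * (1 - prob A))"
proof -
  interpret group G by fact
  let ?h = "inv\<^bsub>G\<^esub> g" let ?v = "prob A * (1 - prob A)"
  have h: "?h \<in> carrier G" using g by simp
  have AM: "A \<subseteq> space M" using A by (rule sets.sets_into_space)
  have img: "x \<in> \<sigma> g ` A \<longleftrightarrow> \<sigma> ?h x \<in> A" if "x \<in> space M" for x
  proof
    assume "x \<in> \<sigma> g ` A"
    then obtain y where y: "y \<in> A" "x = \<sigma> g y" by blast
    then have "y \<in> space M" using AM by blast
    then show "\<sigma> ?h x \<in> A" using pmp_action_inv(1)[OF G \<sigma> g] y by simp
  next
    assume "\<sigma> ?h x \<in> A"
    then have "\<sigma> g (\<sigma> ?h x) \<in> \<sigma> g ` A" by (rule imageI)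
    then show "x \<in> \<sigma> g ` A" using pmp_action_inv(2)[OF G \<sigma> g that] by simp
  qed
  have "\<sigma> g ` A = \<sigma> ?h -` A \<inter> space M"
    using img pmp_action_space[OF \<sigma> g] AM by blast
  then have meas: "\<sigma> g ` A \<in> sets M"
    using measurable_sets[OF pmp_actionD(2)[OF \<sigma> h] A] by simp
  have "(cmod (koopman G \<sigma> g (normalized_indicator M A) x - normalized_indicator M A x))\<^sup>2
      = indicator (sym_diff (\<sigma> g ` A) A) x / ?v" if "x \<in> space M" for x
  proof -
    have "koopman G \<sigma> g (normalized_indicator M A) x - normalized_indicator M A x
        = of_real ((indicator A (\<sigma> ?h x) - indicator A x) / sqrt ?v)"
      by (simp add: koopman_def normalized_indicator_def diff_divide_distrib)
    also have "indicator A (\<sigma> ?h x) = (indicator (\<sigma> g ` A) x :: real)"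
      using img[OF that] by (simp add: indicator_def)
    also have "(cmod (of_real ((indicator (\<sigma> g ` A) x - indicator A x) / sqrt ?v)))\<^sup>2
        = (indicator (\<sigma> g ` A) x - indicator A x)\<^sup>2 / ?v"
      using pos unfolding norm_of_real power2_abs power_divide by simp
    also have "(indicator (\<sigma> g ` A) x - indicator A x)\<^sup>2 = (indicator (sym_diff (\<sigma> g ` A) A) x :: real)"
      by (simp add: indicator_def)
    finally show ?thesis .
  qed
  then have "(LINT x|M. (cmod (koopman G \<sigma> g (normalized_indicator M A) x - normalized_indicator M A x))\<^sup>2)
      = (LINT x|M. indicator (sym_diff (\<sigma> g ` A) A) x / ?v)"
    by (rule Bochner_Integration.integral_cong[OF refl])
  also have "\<dots> = prob (sym_diff (\<sigma> g ` A) A) / ?v"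
    using meas A by simp
  finally show ?thesis by (simp add: L2_norm_square)
qed

text \<open>If asymptotically invariant sets stay away from measures 0 and 1 along a subsequence, then their
centered and normalized indicators form a sequence of almost invariant unit vectors.\<close>

lemma spectral_gap_imp_strongly_ergodic:
  assumes G: "group G" and \<sigma>: "pmp_action G M \<sigma>" and gap: "spectral_gap G M \<sigma>"
  shows "strongly_ergodic M (orbit_equivalence_relation G M \<sigma>)"
  unfolding strongly_ergodic_def
proof (intro allI impI, elim conjE)
  fix A :: "nat \<Rightarrow> 'a set"
  assume A: "\<forall>n. A n \<in> sets M"
    and inv: "\<forall>\<alpha>\<in>full_group M (orbit_equivalence_relation G M \<sigma>).
      (\<lambda>n. prob (sym_diff (\<alpha> ` A n) (A n))) \<longlonglongrightarrow> 0"
  let ?v = "\<lambda>n. prob (A n) * (1 - prob (A n))"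
  have v0: "0 \<le> ?v n" for n by simp
  show "?v \<longlonglongrightarrow> 0"
  proof (rule ccontr)
    assume "\<not> ?v \<longlonglongrightarrow> 0"
    then obtain e where e: "0 < e" "\<And>n. \<exists>k\<ge>n. e \<le> ?v k"
      unfolding LIMSEQ_def using v0 by (auto simp: not_less)
    from choice[of "\<lambda>n k. k \<ge> n \<and> e \<le> ?v k"] e(2)
    obtain r where r: "\<And>n. n \<le> r n" "\<And>n. e \<le> ?v (r n)" by auto
    have pos: "0 < ?v (r n)" for n using e(1) r(2)[of n] by linarith
    have lim_r: "filterlim r at_top sequentially"
      by (rule filterlim_at_top_mono[OF filterlim_ident eventuallyI]) (rule r(1))
    let ?\<xi> = "\<lambda>n. normalized_indicator M (A (r n))"
    have "(\<lambda>n. L2_norm M (\<lambda>x. koopman G \<sigma> g (?\<xi> n) x - ?\<xi> n x)) \<longlonglongrightarrow> 0" if g: "g \<in> carrier G" for g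
    proof -
      let ?d = "\<lambda>n. prob (sym_diff (\<sigma> g ` A (r n)) (A (r n)))"
      have "(\<lambda>n. prob (sym_diff (\<sigma> g ` A n) (A n))) \<longlonglongrightarrow> 0"
        using inv pmp_action_in_full_group[OF G \<sigma> g] by blast
      then have "?d \<longlonglongrightarrow> 0" using lim_r by (rule filterlim_compose)
      then have "(\<lambda>n. sqrt (?d n / e)) \<longlonglongrightarrow> sqrt (0 / e)"
        using e(1) by (intro tendsto_intros) auto
      then have null: "(\<lambda>n. sqrt (?d n / e)) \<longlonglongrightarrow> 0" by simp
      have "norm (L2_norm M (\<lambda>x. koopman G \<sigma> g (?\<xi> n) x - ?\<xi> n x)) \<le> sqrt (?d n / e)" for n
      proof -
        have "(L2_norm M (\<lambda>x. koopman G \<sigma> g (?\<xi> n) x - ?\<xi> n x))\<^sup>2 = ?d n / ?v (r n)"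
          using A by (intro koopman_normalized_indicator G \<sigma> g pos) auto
        also have "\<dots> \<le> ?d n / e"
          using e(1) r(2)[of n] by (intro frac_le) auto
        finally show ?thesis by (simp add: real_le_rsqrt flip: real_sqrt_abs)
      qed
      then show ?thesis by (intro Lim_null_comparison[OF eventuallyI null])
    qed
    moreover have "?\<xi> n \<in> L2_minus_constants M \<and> L2_norm M (?\<xi> n) = 1" for n
      using normalized_indicator_L2[OF _ pos] A by blast
    ultimately show False
      using spec[OF gap[unfolded spectral_gap_def not_ex], of ?\<xi>] by simp
  qed
qed

end

section \<open>Spectral gap and strong ergodicity of coinduced actions\<close>

theorem propositionB:
  fixes \<Gamma> :: "('g, 'm) monoid_scheme"
    and \<Sigma> \<Delta> :: "'g set"
    and X0 :: "'x measure"
    and \<sigma>0 :: "'g \<Rightarrow> 'x \<Rightarrow> 'x"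
    and \<phi> :: "'g set \<Rightarrow> 'g"
  assumes "group \<Gamma>" and "countable (carrier \<Gamma>)"
    and "subgroup \<Sigma> \<Gamma>"
    and "standard_probability_space X0"
    and "pmp_action (\<Gamma>\<lparr>carrier := \<Sigma>\<rparr>) X0 \<sigma>0"
    and "quotient_section \<Gamma> \<Sigma> \<phi>"
    and "subgroup \<Delta> \<Gamma>"
    and "\<not> amenable_relative_to \<Gamma> \<Delta> \<Sigma>"
  shows "spectral_gap (\<Gamma>\<lparr>carrier := \<Delta>\<rparr>) (coinduced_space \<Gamma> \<Sigma> X0)
           (coinduced_action \<Gamma> \<Sigma> X0 \<phi> \<sigma>0) \<and>
         strongly_ergodic (coinduced_space \<Gamma> \<Sigma> X0)
           (orbit_equivalence_relation (\<Gamma>\<lparr>carrier := \<Delta>\<rparr>) (coinduced_space \<Gamma> \<Sigma> X0)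
              (coinduced_action \<Gamma> \<Sigma> X0 \<phi> \<sigma>0))"
proof -
  have "prob_space X0" using assms(4) by (simp add: standard_probability_space_def)
  then interpret X0: prob_space X0 .
  have "iid_product TYPE('g set) X0" by unfold_locales
  then interpret coinduction \<Gamma> \<Sigma> X0 \<sigma>0 \<phi>
    using assms(1,3,5,6) by (intro coinduction.intro coinduction_axioms.intro)
  have gap: "spectral_gap (\<Gamma>\<lparr>carrier := \<Delta>\<rparr>) M \<sigma>"
    using invariant_mean_if_no_spectral_gap[OF assms(7)] assms(8) by blast
  moreover have "strongly_ergodic M (orbit_equivalence_relation (\<Gamma>\<lparr>carrier := \<Delta>\<rparr>) M \<sigma>)"
  proof (rule P.spectral_gap_imp_strongly_ergodic[OF _ _ gap])
    show "group (\<Gamma>\<lparr>carrier := \<Delta>\<rparr>)"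
      using assms(7,1) by (rule subgroup.subgroup_is_group)
    show "pmp_action (\<Gamma>\<lparr>carrier := \<Delta>\<rparr>) M \<sigma>"
      using assms(1) pmp_action_coinduced assms(7) by (rule pmp_action_subgroup)
  qed
  ultimately show ?thesis by (simp add: coinduced_space_eq)
qed

end
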